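(* Let $q\ge 2$ and let $\{n_j\}_{j=0}^\infty$ be a sequence in $\mathbb{N}$ such that $n_0=1$ and $$\frac{n_{j+1}}{n_j}\ge q\quad\text{for all } j\in\mathbb{Z}^+ .$$ Let $\{\delta_j\}_{j\in\mathbb{Z}^+}\in\ell^2(\mathbb{Z}^+)$ be a sequence of complex numbers with $\|\{\delta_j\}\|_{\ell^\infty(\mathbb{Z}^+)}<1$. Define $F=\{F_n\}_{n\in\mathbb{Z}}$ by $F_{n_j}=\delta_j$ for all $j\in\mathbb{Z}^+$ and $F_n=0$ for all other $n\in\mathbb{Z}$. Then, for any $p\in[2,\infty)$, the $SU(1,1)$ nonlinear Fourier transforms $$\begin{pmatrix}\mathfrak{a}(z,F^{\langle N\rangle})\\ \mathfrak{b}(z,F^{\langle N\rangle})\end{pmatrix}$$ of the truncations $F^{\langle N\rangle}$ converge in $L^p(\mathbb{T},m)$ as $N\to\infty$; that is, both components $\mathfrak{a}(\cdot,F^{\langle N\rangle})$ and $\mathfrak{b}(\cdot,F^{\langle N\rangle})$ have limits in $L^p(\mathbb{T},m)$.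
   Context: $\mathbb{N}=\{1,2,\ldots\}$, $\mathbb{Z}^+=\{0,1,2,\ldots\}$, $\mathbb{T}$ is the unit circle in $\mathbb{C}$, and $m$ is the normalized Lebesgue measure on $\mathbb{T}$ ($dm=(2\pi)^{-1}d\theta$). For a sequence $F=\{F_n\}_{n\in\mathbb{Z}}$ of complex numbers with $|F_n|<1$ for all $n$, and for $N\in\mathbb{Z}^+$, the truncation is $F^{\langle N\rangle}_n=F_n$ if $|n|\le N$ and $F^{\langle N\rangle}_n=0$ otherwise. Define $2\times2$ matrices $\widetilde X_n(z,F^{\langle N\rangle})$, $n\in\mathbb{Z}$, by $\widetilde X_n=I$ for $n<-N$ and $$\widetilde X_n=\frac{1}{(1-|F_n^{\langle N\rangle}|^2)^{1/2}}\begin{pmatrix}1&\overline{F_n^{\langle N\rangle}}z^{-n}\\ F_n^{\langle N\rangle}z^n&1\end{pmatrix}\widetilde X_{n-1}.$$ These matrices have the form $$\widetilde X_n(z,F^{\langle N\rangle})=\begin{pmatrix}\mathfrak{a}_n(z,F^{\langle N\rangle})&\mathfrak{b}_n^{( * )}(z,F^{\langle N\rangle})\\ \mathfrak{b}_n(z,F^{\langle N\rangle})&\mathfrak{a}_n^{( * )}(z,F^{\langle N\rangle})\end{pmatrix},\qquad f^{( * )}(z):=\overline{f(\bar z^{-1})},$$ so $f^{( * )}(z)=\overline{f(z)}$ for $z\in\mathbb{T}$. Since $\widetilde X_n$ does not depend on $n$ for $n\ge N$, one sets $\mathfrak{a}(z,F^{\langle N\rangle}):=\mathfrak{a}_n(z,F^{\langle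 N\rangle})$ and $\mathfrak{b}(z,F^{\langle N\rangle}):=\mathfrak{b}_n(z,F^{\langle N\rangle})$ for any $n\ge N$. The $SU(1,1)$ nonlinear Fourier transform of $F^{\langle N\rangle}$ is the column vector $\begin{pmatrix}\mathfrak{a}(z,F^{\langle N\rangle})\\ \mathfrak{b}(z,F^{\langle N\rangle})\end{pmatrix}$. *)

theory Defs
  imports "HOL-Analysis.Analysis"
begin

definition trunc :: "nat \<Rightarrow> (int \<Rightarrow> complex) \<Rightarrow> int \<Rightarrow> complex" where
  "trunc N F n = (if \<bar>n\<bar> \<le> int N then F n else 0)"

definition step_matrix :: "complex \<Rightarrow> int \<Rightarrow> complex \<Rightarrow> complex^2^2" where
  "step_matrix c n z =
     vector [vector [1, cnj c * z powi (- n)],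
             vector [c * z powi n, 1]]"

text \<open>The matrices $\widetilde X_n(z, F^{\langle N\rangle})$; the truncation is built in.\<close>

function X_matrix :: "nat \<Rightarrow> (int \<Rightarrow> complex) \<Rightarrow> complex \<Rightarrow> int \<Rightarrow> complex^2^2" where
  "X_matrix N F z n =
     (if n < - int N then mat 1
      else ((1 / sqrt (1 - (cmod (trunc N F n))\<^sup>2)) *\<^sub>R step_matrix (trunc N F n) n z)
             ** X_matrix N F z (n - 1))"
  by pat_completeness auto
termination
  by (relation "Wellfounded.measure (\<lambda>(N, F, z, n). nat (n + int N + 1))") auto

declare X_matrix.simps [simp del]

definition a_entry :: "nat \<Rightarrow> (int \<Rightarrow> complex) \<Rightarrow> int \<Rightarrow> complex \<Rightarrow> complex" where
  "a_entry N F n z = X_matrix N F z n $ 1 $ 1"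

definition b_entry :: "nat \<Rightarrow> (int \<Rightarrow> complex) \<Rightarrow> int \<Rightarrow> complex \<Rightarrow> complex" where
  "b_entry N F n z = X_matrix N F z n $ 2 $ 1"

text \<open>The two components of the $SU(1,1)$ nonlinear Fourier transform of the truncation.
  They are read off at $n = N$; by \<open>X_matrix_stationary\<close> any $n \ge N$ gives the same value.\<close>

definition nlft_a :: "(int \<Rightarrow> complex) \<Rightarrow> nat \<Rightarrow> complex \<Rightarrow> complex" where
  "nlft_a F N z = a_entry N F (int N) z"

definition nlft_b :: "(int \<Rightarrow> complex) \<Rightarrow> nat \<Rightarrow> complex \<Rightarrow> complex" where
  "nlft_b F N z = b_entry N F (int N) z"

lemma X_matrix_stationary:
  assumes "n \<ge> int N"
  shows "X_matrix N F z n = X_matrix N F z (int N)"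
  using assms
proof (induction n rule: int_ge_induct)
  case (step n)
  have "step_matrix 0 k z = mat 1" for k
    by (simp add: step_matrix_def mat_def vec_eq_iff forall_2)
  then have "X_matrix N F z (n + 1) = X_matrix N F z n"
    using step.hyps by (subst X_matrix.simps) (simp add: trunc_def)
  with step.IH show ?case by simp
qed simp

text \<open>Normalized Lebesgue measure on the unit circle: the image of $(2\pi)^{-1}d\theta$
  on $[0, 2\pi)$ under $\theta \mapsto e^{i\theta}$.\<close>

definition circle_measure :: "complex measure" where
  "circle_measure =
     distr (uniform_measure lborel {0..<2 * pi}) (restrict_space borel (sphere 0 1)) cis"

lemma emeasure_circle_measure: "emeasure circle_measure (sphere 0 1) = 1"
proof -
  have "cis \<in> lborel \<rightarrow>\<^sub>M restrict_space borel (sphere 0 1)"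
    by (intro measurable_restrict_space2)
       (auto intro!: borel_measurable_continuous_onI continuous_intros)
  then have m: "cis \<in> uniform_measure lborel {0..<2 * pi} \<rightarrow>\<^sub>M restrict_space borel (sphere 0 1)"
    by simp
  have "emeasure circle_measure (sphere 0 1) =
      emeasure (uniform_measure lborel {0..<2 * pi}) (cis -` sphere 0 1)"
    unfolding circle_measure_def
    by (subst emeasure_distr[OF m]) (auto simp: sets_restrict_space)
  also have "cis -` sphere 0 1 = UNIV"
    by auto
  also have "emeasure (uniform_measure lborel {0..<2 * pi}) UNIV = 1"
    by (subst emeasure_uniform_measure) (auto intro!: ennreal_divide_self)
  finally show ?thesis .
qed

definition Lp_space :: "real \<Rightarrow> 'a measure \<Rightarrow> ('a \<Rightarrow> complex) set" where
  "Lp_space p M =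
     {f. f \<in> borel_measurable M \<and> integrable M (\<lambda>x. cmod (f x) powr p)}"

definition Lp_norm :: "real \<Rightarrow> 'a measure \<Rightarrow> ('a \<Rightarrow> complex) \<Rightarrow> real" where
  "Lp_norm p M f = (\<integral>x. cmod (f x) powr p \<partial>M) powr (1 / p)"

text \<open>Membership of all functions in \<open>Lp_space\<close> is required explicitly, because the
  Bochner integral of a non-integrable function is 0.\<close>

definition Lp_limit ::
  "real \<Rightarrow> 'a measure \<Rightarrow> (nat \<Rightarrow> 'a \<Rightarrow> complex) \<Rightarrow> ('a \<Rightarrow> complex) \<Rightarrow> bool" where
  "Lp_limit p M f g \<longleftrightarrow>
     (\<forall>N. f N \<in> Lp_space p M) \<and> g \<in> Lp_space p M \<and>
     (\<lambda>N. Lp_norm p M (\<lambda>x. f N x - g x)) \<longlonglongrightarrow> 0"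

end

theory Submission
  imports Defs
begin

text \<open>
  Drop the scalar factors $(1 - |\delta_j|^2)^{-1/2}$, whose product converges. The remaining recursion
  is $A_{j+1} = A_j + \overline{\delta_j} z^{-n_j} B_j$, $B_{j+1} = B_j + \delta_j z^{n_j} A_j$, and
  since $n_{j+1} \ge 2 n_j$ the spectra of $A_j$ and $B_j$ lie in $[-n_{j-1}, 0]$ and $[0, n_{j-1}]$.

  It suffices to treat an even exponent $2k \ge p$. There an elementary expansion replaces the
  Littlewood--Paley inequality: split the increments $f_j$ into residue classes mod $M$ with
  $2^M \ge 4k$. If $S$ is a partial sum over earlier members of the class of $j$, then
  $$|S + f_j|^{2k} \le |S|^{2k} + 2k |S|^{2k-2} \mathrm{Re}(\overline{S} f_j)
      + 3 k^2 (|S| + |f_j|)^{2k-2} |f_j|^2,$$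
  and the middle term integrates to zero. Hence a block of increments has $2k$-th moment at most
  $K Q \sum_j |\delta_j|^2$, where $Q$ bounds the moments of the $A_j$, $B_j$ involved. Over a tail with
  small $\sum_j |\delta_j|^2$ this bounds the moments uniformly, and then it makes $A_j$ and $B_j$ Cauchy.
\<close>

section \<open>Trigonometric polynomials on the circle\<close>

text \<open>The bounds \<open>l\<close> and \<open>u\<close> enclose the spectrum, so one-sided
  information survives products and conjugation. Rule \<open>cong\<close> asks for agreement on the
  unit circle only: the laws for integer powers fail at 0, and conjugation inverts \<open>z\<close>
  only on the circle.\<close>

inductive trig_poly :: "int \<Rightarrow> int \<Rightarrow> (complex \<Rightarrow> complex) \<Rightarrow> bool" for l u where
  zero: "trig_poly l u (\<lambda>z. 0)"
| monom: "l \<le> m \<Longrightarrow> m \<le> u \<Longrightarrow> trig_poly l u (\<lambda>z. c * z powi m)"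
| add: "trig_poly l u f \<Longrightarrow> trig_poly l u g \<Longrightarrow> trig_poly l u (\<lambda>z. f z + g z)"
| cong: "trig_poly l u f \<Longrightarrow> (\<And>z. z \<in> sphere 0 1 \<Longrightarrow> g z = f z) \<Longrightarrow> trig_poly l u g"

lemma trig_poly_mono:
  assumes "trig_poly l u f" "l' \<le> l" "u \<le> u'"
  shows "trig_poly l' u' f"
  using assms by induction (auto intro: trig_poly.intros)

lemma sphere_0_nonzero: "z \<in> sphere 0 1 \<Longrightarrow> z \<noteq> (0::complex)"
  by auto

lemma trig_poly_mult_monom:
  assumes "trig_poly l u f"
  shows "trig_poly (l + m) (u + m) (\<lambda>z. c * z powi m * f z)"
  using assms
proof induction
  case zero
  then show ?case by (simp add: trig_poly.zero)
next
  case (monom k d)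
  show ?case
  proof (rule trig_poly.cong)
    show "trig_poly (l + m) (u + m) (\<lambda>z. (c * d) * z powi (k + m))"
      using monom by (intro trig_poly.monom) auto
  qed (use sphere_0_nonzero in \<open>auto simp: power_int_add\<close>)
next
  case (add f g)
  show ?case
    using trig_poly.add[OF add.IH] by (simp add: ring_distribs)
next
  case (cong f g)
  show ?case
    by (rule trig_poly.cong[OF cong.IH]) (simp add: cong.hyps)
qed

lemma trig_poly_mult:
  assumes "trig_poly l u f" "trig_poly l' u' g"
  shows "trig_poly (l + l') (u + u') (\<lambda>z. f z * g z)"
  using assms(1)
proof induction
  case zero
  then show ?case by (simp add: trig_poly.zero)
next
  case (monom k d)
  show ?case
    by (rule trig_poly_mono[OF trig_poly_mult_monom[OF assms(2)]]) (use monom in auto)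
next
  case (add f g)
  show ?case
    using trig_poly.add[OF add.IH] by (simp add: ring_distribs)
next
  case (cong f g)
  show ?case
    by (rule trig_poly.cong[OF cong.IH]) (simp add: cong.hyps)
qed

lemma trig_poly_const: "trig_poly 0 0 (\<lambda>z. c)"
  using trig_poly.monom[of 0 0 0 c] by simp

lemma trig_poly_power:
  assumes "trig_poly l u f"
  shows "trig_poly (int m * l) (int m * u) (\<lambda>z. f z ^ m)"
proof (induction m)
  case 0
  show ?case using trig_poly_const[of 1] by simp
next
  case (Suc m)
  show ?case using trig_poly_mult[OF assms Suc.IH] by (simp add: algebra_simps)
qed

text \<open>On the circle conjugation inverts \<open>z\<close>, so the spectrum is reflected about
  0.\<close>

lemma trig_poly_cnj:
  assumes "trig_poly l u f"
  shows "trig_poly (- u) (- l) (\<lambda>z. cnj (f z))"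
  using assms
proof induction
  case zero
  then show ?case by (simp add: trig_poly.zero)
next
  case (monom k d)
  show ?case
  proof (rule trig_poly.cong)
    show "trig_poly (- u) (- l) (\<lambda>z. cnj d * z powi (- k))"
      using monom by (intro trig_poly.monom) auto
    fix z :: complex assume "z \<in> sphere 0 1"
    then have "cnj z = inverse z"
      using complex_norm_square[of z] by (intro inverse_unique[symmetric]) simp
    then show "cnj (d * z powi k) = cnj d * z powi (- k)"
      by (simp add: power_int_minus power_int_inverse)
  qed
next
  case (add f g)
  show ?case
    using trig_poly.add[OF add.IH] by simp
next
  case (cong f g)
  show ?case
    by (rule trig_poly.cong[OF cong.IH]) (simp add: cong.hyps)
qed

lemma trig_poly_sum:
  assumes "\<And>i. i \<in> I \<Longrightarrow> trig_poly l u (f i)"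
  shows "trig_poly l u (\<lambda>z. \<Sum>i\<in>I. f i z)"
  using assms by (induction I rule: infinite_finite_induct) (auto intro: trig_poly.intros)

lemma trig_poly_continuous: "trig_poly l u f \<Longrightarrow> continuous_on (sphere 0 1) f"
proof (induction rule: trig_poly.induct)
  case (cong f g)
  then show ?case using continuous_on_cong by blast
qed (auto intro!: continuous_intros)

section \<open>Integration against the normalized measure on the circle\<close>

lemma measurable_cis:
  "cis \<in> uniform_measure lborel {0..<2 * pi} \<rightarrow>\<^sub>M restrict_space borel (sphere 0 1)"
proof -
  have "cis \<in> lborel \<rightarrow>\<^sub>M restrict_space borel (sphere 0 1)"
    by (intro measurable_restrict_space2)
       (auto intro!: borel_measurable_continuous_onI continuous_intros)
  then show ?thesis by simp
qed

lemma space_circle_measure [simp]: "space circle_measure = sphere 0 1"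
  by (simp add: circle_measure_def space_restrict_space)

lemma finite_measure_circle: "finite_measure circle_measure"
  by standard (simp add: emeasure_circle_measure)

lemma measurable_circle:
  fixes f :: "complex \<Rightarrow> 'b::topological_space"
  assumes "continuous_on (sphere 0 1) f"
  shows "f \<in> borel_measurable circle_measure"
  using borel_measurable_continuous_on_restrict[OF assms] by (simp add: circle_measure_def)

lemma integrable_circle:
  fixes f :: "complex \<Rightarrow> 'b::{banach, second_countable_topology}"
  assumes "continuous_on (sphere 0 1) f"
  shows "integrable circle_measure f"
proof -
  have "compact (f ` sphere 0 1)"
    using assms by (intro compact_continuous_image) auto
  then obtain B where "\<forall>x\<in>f ` sphere 0 1. norm x \<le> B"
    using compact_imp_bounded bounded_iff by blast
  then show ?thesis
    by (intro finite_measure.integrable_const_bound[OF finite_measure_circle, of f B])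
       (auto simp: measurable_circle[OF assms] intro!: AE_I2)
qed

lemma integral_circle_monom:
  assumes "m \<noteq> 0"
  shows "(LINT z|circle_measure. z powi m) = (0::complex)"
proof -
  have "(LINT z|circle_measure. z powi m) =
      (LINT t|uniform_measure lborel {0..<2 * pi}. cis t powi m)"
    unfolding circle_measure_def
    by (rule integral_distr[OF measurable_cis])
       (auto intro!: borel_measurable_continuous_on_restrict continuous_intros)
  also have "\<dots> = (LINT t|uniform_measure lborel {0..<2 * pi}. cis (m * t))"
    by (simp add: cis_power_int)
  also have "\<dots> = (LINT t|lborel. (indicator {0..<2 * pi} t / (2 * pi)) *\<^sub>R cis (m * t))"
  proof -
    have "uniform_measure lborel {0..<2 * pi} =
        density lborel (\<lambda>t. ennreal (indicator {0..<2 * pi} t / (2 * pi)))"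
      unfolding uniform_measure_def
      by (rule density_cong) (auto simp: divide_ennreal indicator_def simp flip: ennreal_1)
    then show ?thesis
      by (simp add: integral_density borel_measurable_continuous_onI continuous_intros)
  qed
  \<comment> \<open>The interval is closed up at the null point \<open>2 * pi\<close>, because the
    fundamental theorem of calculus is applied on a closed interval.\<close>
  also have "\<dots> = (LINT t|lborel. (1 / (2 * pi)) *\<^sub>R (indicator {0..2 * pi} t *\<^sub>R cis (m * t)))"
  proof (rule integral_cong_AE)
    have "AE t in lborel. t \<noteq> 2 * pi"
      by (rule AE_lborel_singleton)
    then show "AE t in lborel. (indicator {0..<2 * pi} t / (2 * pi)) *\<^sub>R cis (m * t) =
        (1 / (2 * pi)) *\<^sub>R (indicator {0..2 * pi} t *\<^sub>R cis (m * t))"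
      by eventually_elim (auto simp: indicator_def)
  qed (simp_all add: borel_measurable_continuous_onI continuous_intros
      borel_measurable_scaleR borel_measurable_divide)
  also have "\<dots> = 0"
  proof -
    have "(LINT t|lborel. indicator {0..2 * pi} t *\<^sub>R cis (m * t)) =
        cis (m * (2 * pi)) / (\<i> * m) - cis (m * (0::real)) / (\<i> * m)"
    proof (rule integral_FTC_Icc[where F = "\<lambda>t. cis (m * t) / (\<i> * m)"])
      fix t :: real
      show "((\<lambda>t. cis (m * t) / (\<i> * m)) has_vector_derivative cis (m * t)) (at t within {0..2 * pi})"
        using assms
        by (auto intro!: derivative_eq_intros simp: has_vector_derivative_def scaleR_conv_of_real
              mult.left_commute[of "complex_of_real _"])
    qed (auto intro!: continuous_intros)
    also have "cis (m * (2 * pi)) = 1"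
      by (metis cis_multiple_2pi Ints_of_int mult.assoc mult.commute)
    finally show ?thesis unfolding integral_scaleR_right by simp
  qed
  finally show ?thesis .
qed

text \<open>Either condition keeps the frequency 0 out of the spectrum, and every other monomial has
  mean zero.\<close>

lemma integral_trig_poly_eq_0:
  assumes "trig_poly l u f" "0 < l \<or> u < 0"
  shows "(LINT z|circle_measure. f z) = 0"
  using assms(1)
proof induction
  case (monom m c)
  then show ?case using integral_circle_monom[of m] assms(2) by auto
next
  case (add f g)
  then show ?case
    by (simp add: integrable_circle trig_poly_continuous)
next
  case (cong f g)
  then show ?case
    by (metis Bochner_Integration.integral_cong space_circle_measure)
qed auto

section \<open>Even moments\<close>

text \<open>Induction on \<open>k\<close>: the bound for \<open>k\<close> is multiplied by |S + f|^2
  = |S|^2 + 2 Re (cnj S f) + |f|^2. The first-order term is kept exactly, since it will integrate to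
  zero; everything of second order in \<open>f\<close> goes into the remainder.\<close>

lemma norm_add_even_power_le:
  fixes S f :: complex
  assumes "k \<ge> 1"
  shows "cmod (S + f) ^ (2 * k) \<le>
    cmod S ^ (2 * k) + 2 * k * (cmod S ^ (2 * k - 2) * Re (cnj S * f)) +
    (3 * (real k)\<^sup>2) * ((cmod S + cmod f) ^ (2 * k - 2) * (cmod f)\<^sup>2)"
  using assms
proof (induction k rule: dec_induct)
  case base
  have "(cmod (S + f))\<^sup>2 = (cmod S)\<^sup>2 + 2 * Re (cnj S * f) + (cmod f)\<^sup>2"
    unfolding cmod_power2 by (simp add: power2_eq_square algebra_simps)
  then show ?case by simp
next
  case (step k)
  define x y \<rho> s where "x = (cmod S)\<^sup>2" "y = cmod f" "\<rho> = Re (cnj S * f)" "s = cmod S + cmod f"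
  obtain m where k: "k = Suc m" using step.hyps by (cases k) auto
  have expand: "(cmod (S + f))\<^sup>2 = x + 2 * \<rho> + y\<^sup>2"
    unfolding cmod_power2 x_y_\<rho>_s_def by (simp add: power2_eq_square algebra_simps)
  have nonneg: "x \<ge> 0" "y \<ge> 0" "s \<ge> 0" by (auto simp: x_y_\<rho>_s_def)
  have tri: "(cmod (S + f))\<^sup>2 \<le> s\<^sup>2"
    unfolding x_y_\<rho>_s_def by (intro power_mono norm_triangle_ineq) auto
  have xs: "x \<le> s\<^sup>2" unfolding x_y_\<rho>_s_def by (intro power_mono) auto
  have rho: "\<bar>\<rho>\<bar> \<le> cmod S * y"
    unfolding x_y_\<rho>_s_def using abs_Re_le_cmod[of "cnj S * f"] by (simp add: norm_mult)
  then have rho2: "\<rho>\<^sup>2 \<le> x * y\<^sup>2"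
    using power_mono[OF rho, of 2] by (simp add: x_y_\<rho>_s_def power_mult_distrib)
  have rho1: "\<rho> \<le> s\<^sup>2"
  proof -
    have "cmod S * y \<le> s * s"
      unfolding x_y_\<rho>_s_def by (intro mult_mono) auto
    then show ?thesis using rho by (simp add: power2_eq_square)
  qed
  have xk: "x ^ j \<le> s ^ (2 * j)" for j
    using power_mono[OF xs nonneg(1), of j] by (simp add: power_mult)
  have "cmod (S + f) ^ (2 * Suc k) = cmod (S + f) ^ (2 * k) * (cmod (S + f))\<^sup>2"
    by (simp flip: power_add)
  also have "\<dots> \<le> (x ^ k + 2 * k * (x ^ m * \<rho>) + (3 * (real k)\<^sup>2) * (s ^ (2 * m) * y\<^sup>2)) * (cmod (S + f))\<^sup>2"
  proof (intro mult_right_mono)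
    have "cmod S ^ (2 * k) = x ^ k" "cmod S ^ (2 * k - 2) = x ^ m" "s ^ (2 * k - 2) = s ^ (2 * m)"
      by (simp_all add: x_y_\<rho>_s_def k power_mult power2_eq_square)
    then show "cmod (S + f) ^ (2 * k) \<le>
        x ^ k + 2 * k * (x ^ m * \<rho>) + (3 * (real k)\<^sup>2) * (s ^ (2 * m) * y\<^sup>2)"
      using step.IH unfolding x_y_\<rho>_s_def by simp
  qed simp
  \<comment> \<open>The first bracket can have either sign, so it is multiplied by the exact
    expansion; only the nonnegative remainder is estimated by the triangle inequality.\<close>
  also have "\<dots> = (x ^ k + 2 * k * (x ^ m * \<rho>)) * (x + 2 * \<rho> + y\<^sup>2) +
      (3 * (real k)\<^sup>2) * (s ^ (2 * m) * y\<^sup>2) * (cmod (S + f))\<^sup>2"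
    unfolding expand by (simp add: algebra_simps)
  also have "\<dots> \<le> (x ^ k + 2 * k * (x ^ m * \<rho>)) * (x + 2 * \<rho> + y\<^sup>2) +
      (3 * (real k)\<^sup>2) * (s ^ (2 * m) * y\<^sup>2) * s\<^sup>2"
    using tri nonneg by (intro add_left_mono mult_left_mono) auto
  also have "\<dots> = x ^ Suc k + 2 * Suc k * (x ^ k * \<rho>) + 4 * k * (x ^ m * \<rho>\<^sup>2) +
      x ^ k * y\<^sup>2 + 2 * k * (x ^ m * \<rho> * y\<^sup>2) + (3 * (real k)\<^sup>2) * (s ^ (2 * k) * y\<^sup>2)"
    by (simp add: k algebra_simps power2_eq_square)
  also have "\<dots> \<le> x ^ Suc k + 2 * Suc k * (x ^ k * \<rho>) + 4 * k * (s ^ (2 * k) * y\<^sup>2) +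
      s ^ (2 * k) * y\<^sup>2 + 2 * k * (s ^ (2 * k) * y\<^sup>2) + (3 * (real k)\<^sup>2) * (s ^ (2 * k) * y\<^sup>2)"
  proof -
    have "x ^ m * \<rho>\<^sup>2 \<le> x ^ m * (x * y\<^sup>2)"
      using rho2 nonneg by (intro mult_left_mono) auto
    also have "\<dots> = x ^ k * y\<^sup>2" by (simp add: k)
    finally have 1: "x ^ m * \<rho>\<^sup>2 \<le> x ^ k * y\<^sup>2" .
    have 2: "x ^ k * y\<^sup>2 \<le> s ^ (2 * k) * y\<^sup>2"
      by (intro mult_right_mono xk) auto
    have "x ^ m * \<rho> \<le> x ^ m * s\<^sup>2"
      using rho1 nonneg by (intro mult_left_mono) auto
    also have "\<dots> \<le> s ^ (2 * m) * s\<^sup>2"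
      by (intro mult_right_mono xk) auto
    also have "\<dots> = s ^ (2 * k)" by (simp add: k power2_eq_square)
    finally have 3: "x ^ m * \<rho> * y\<^sup>2 \<le> s ^ (2 * k) * y\<^sup>2"
      by (intro mult_right_mono) auto
    show ?thesis
      by (intro add_mono mult_left_mono order.refl 2 3 order.trans[OF 1 2]) auto
  qed
  \<comment> \<open>The second-order terms add up to 3k^2 + 4k + 1 + 2k = 3(k + 1)^2 - 2, which is
    why the constant 3k^2 reproduces itself.\<close>
  also have "\<dots> = x ^ Suc k + 2 * Suc k * (x ^ k * \<rho>) + (3 * (real (Suc k))\<^sup>2 - 2) * (s ^ (2 * k) * y\<^sup>2)"
    by (simp add: algebra_simps power2_eq_square)
  also have "\<dots> \<le> x ^ Suc k + 2 * Suc k * (x ^ k * \<rho>) + (3 * (real (Suc k))\<^sup>2) * (s ^ (2 * k) * y\<^sup>2)"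
    using nonneg by (intro add_left_mono mult_right_mono) auto
  finally have bound: "cmod (S + f) ^ (2 * Suc k) \<le>
      x ^ Suc k + 2 * Suc k * (x ^ k * \<rho>) + (3 * (real (Suc k))\<^sup>2) * (s ^ (2 * k) * y\<^sup>2)" .
  have "x ^ Suc k = cmod S ^ (2 * Suc k)" "x ^ k = cmod S ^ (2 * Suc k - 2)"
    "s ^ (2 * k) = s ^ (2 * Suc k - 2)"
    by (simp_all add: x_y_\<rho>_s_def power_mult power2_eq_square)
  note eqs = this
  show ?case using bound unfolding eqs unfolding x_y_\<rho>_s_def by (simp only: of_nat_mult)
qed

text \<open>The sum is at most \<open>card I\<close> times its largest term. This crude constant
  suffices, so no convexity is invoked.\<close>

lemma sum_power_le:
  fixes a :: "'i \<Rightarrow> real"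
  assumes "finite I" "I \<noteq> {}" "\<And>i. i \<in> I \<Longrightarrow> 0 \<le> a i"
  shows "(\<Sum>i\<in>I. a i) ^ m \<le> real (card I) ^ m * (\<Sum>i\<in>I. a i ^ m)"
proof -
  define b where "b = Max (a ` I)"
  have "b \<in> a ` I" unfolding b_def using assms(1,2) by (intro Max_in) auto
  then obtain j where j: "j \<in> I" "b = a j" by blast
  have "(\<Sum>i\<in>I. a i) \<le> card I * b"
    using sum_bounded_above[of I a b] assms(1) by (auto simp: b_def)
  then have "(\<Sum>i\<in>I. a i) ^ m \<le> (card I * b) ^ m"
    by (intro power_mono sum_nonneg assms)
  also have "\<dots> = real (card I) ^ m * a j ^ m"
    by (simp add: power_mult_distrib j)
  also have "\<dots> \<le> real (card I) ^ m * (\<Sum>i\<in>I. a i ^ m)"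
    using assms j by (intro mult_left_mono member_le_sum) auto
  finally show ?thesis .
qed

lemma add_power_le:
  fixes a b :: real
  assumes "0 \<le> a" "0 \<le> b"
  shows "(a + b) ^ m \<le> 2 ^ m * (a ^ m + b ^ m)"
  using sum_power_le[of "UNIV :: bool set" "\<lambda>i. if i then a else b" m] assms
  by (simp add: UNIV_bool add.commute)

lemma norm_add_power_le:
  "norm (x + y) ^ m \<le> 2 ^ m * (norm x ^ m + norm y ^ m)"
  by (rule order.trans[OF power_mono[OF norm_triangle_ineq] add_power_le]) auto

text \<open>The \<open>m\<close>-th root of an L^m norm is not taken, so that pointwise expansions
  of \<open>2k\<close>-th powers can be integrated term by term.\<close>

definition moment :: "nat \<Rightarrow> (complex \<Rightarrow> complex) \<Rightarrow> real" where
  "moment m f = (LINT z|circle_measure. cmod (f z) ^ m)"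

lemma moment_nonneg [simp]: "0 \<le> moment m f"
  by (simp add: moment_def)

lemma integrable_moment:
  "continuous_on (sphere 0 1) f \<Longrightarrow> integrable circle_measure (\<lambda>z. cmod (f z) ^ m)"
  by (intro integrable_circle continuous_intros)

lemma moment_cong:
  assumes "\<And>z. z \<in> sphere 0 1 \<Longrightarrow> cmod (f z) = cmod (g z)"
  shows "moment m f = moment m g"
  unfolding moment_def by (intro Bochner_Integration.integral_cong) (use assms in auto)

lemma moment_add_le:
  assumes "continuous_on (sphere 0 1) f" "continuous_on (sphere 0 1) g"
  shows "moment m (\<lambda>z. f z + g z) \<le> 2 ^ m * (moment m f + moment m g)"
proof -
  have "moment m (\<lambda>z. f z + g z) \<le>
      (LINT z|circle_measure. 2 ^ m * (cmod (f z) ^ m + cmod (g z) ^ m))"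
    unfolding moment_def using assms
    by (intro integral_mono integrable_circle continuous_intros norm_add_power_le)
  also have "\<dots> = 2 ^ m * (moment m f + moment m g)"
    unfolding moment_def by (simp add: integrable_moment assms)
  finally show ?thesis .
qed

lemma moment_sum_le:
  assumes "finite I" "I \<noteq> {}" "\<And>i. i \<in> I \<Longrightarrow> continuous_on (sphere 0 1) (f i)"
  shows "moment m (\<lambda>z. \<Sum>i\<in>I. f i z) \<le> real (card I) ^ m * (\<Sum>i\<in>I. moment m (f i))"
proof -
  have "moment m (\<lambda>z. \<Sum>i\<in>I. f i z) \<le>
      (LINT z|circle_measure. real (card I) ^ m * (\<Sum>i\<in>I. cmod (f i z) ^ m))"
    unfolding moment_def
  proof (intro integral_mono integrable_circle continuous_intros assms)
    fix z
    have "cmod (\<Sum>i\<in>I. f i z) ^ m \<le> (\<Sum>i\<in>I. cmod (f i z)) ^ m"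
      by (intro power_mono norm_sum) auto
    also have "\<dots> \<le> real (card I) ^ m * (\<Sum>i\<in>I. cmod (f i z) ^ m)"
      by (intro sum_power_le assms) auto
    finally show "cmod (\<Sum>i\<in>I. f i z) ^ m \<le> real (card I) ^ m * (\<Sum>i\<in>I. cmod (f i z) ^ m)" .
  qed auto
  also have "\<dots> = real (card I) ^ m * (\<Sum>i\<in>I. moment m (f i))"
    unfolding moment_def by (simp add: integrable_moment assms Bochner_Integration.integral_sum)
  finally show ?thesis .
qed

lemma moment_scale: "moment m (\<lambda>z. c * f z) = cmod c ^ m * moment m f"
  by (simp add: moment_def norm_mult power_mult_distrib)

text \<open>The first-order term is the real part of a trigonometric polynomial whose spectrum lies
  within distance (2k - 1)D + E of \<open>w\<close>. As |w| exceeds this distance, frequency 0 does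
  not occur and the term integrates to zero. Only the remainder, quadratic in \<open>d\<close>, is
  left.\<close>

lemma moment_add_lacunary_le:
  assumes "k \<ge> 1" "cmod d \<le> 1" "\<bar>w\<bar> > (2 * int k - 1) * D + E"
    and S: "trig_poly (- D) D S" and g: "trig_poly (- E) E g"
  shows "moment (2 * k) (\<lambda>z. S z + d * z powi w * g z) \<le> moment (2 * k) S +
    (3 * (real k)\<^sup>2) * 4 ^ k * (cmod d)\<^sup>2 * (moment (2 * k) S + moment (2 * k) g)"
proof -
  obtain m where k: "k = Suc m" using assms(1) by (cases k) auto
  define f where "f = (\<lambda>z. d * z powi w * g z)"
  \<comment> \<open>The factor |S|^(2k-2) is written as a product of powers of \<open>S\<close> and
    \<open>cnj S\<close>, which exhibits the first-order term as a trigonometric polynomial.\<close>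
  define h where "h = (\<lambda>z. S z ^ m * cnj (S z) ^ m * cnj (S z) * f z)"
  have f: "trig_poly (- E + w) (E + w) f"
    unfolding f_def by (rule trig_poly_mult_monom[OF g])
  have h: "trig_poly (- ((2 * int k - 1) * D + E) + w) ((2 * int k - 1) * D + E + w) h"
    unfolding h_def
    by (rule trig_poly_mono[OF trig_poly_mult[OF trig_poly_mult[OF trig_poly_mult[OF
          trig_poly_power[OF S] trig_poly_power[OF trig_poly_cnj[OF S]]] trig_poly_cnj[OF S]] f]])
       (simp_all add: k algebra_simps)
  have cont: "continuous_on (sphere 0 1) S" "continuous_on (sphere 0 1) g"
    "continuous_on (sphere 0 1) f" "continuous_on (sphere 0 1) h"
    using S g f h by (auto intro: trig_poly_continuous)
  have "(LINT z|circle_measure. h z) = 0"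
    by (rule integral_trig_poly_eq_0[OF h]) (use assms(3) in auto)
  then have "(LINT z|circle_measure. Re (h z)) = 0"
    using integral_Re[OF integrable_circle[OF cont(4)]] by simp
  have Re_h: "cmod (S z) ^ (2 * k - 2) * Re (cnj (S z) * f z) = Re (h z)" for z
  proof -
    have "complex_of_real (cmod (S z) ^ (2 * m)) = of_real ((cmod (S z))\<^sup>2) ^ m"
      by (simp add: power_mult)
    also have "\<dots> = S z ^ m * cnj (S z) ^ m"
      by (simp only: complex_norm_square power_mult_distrib)
    finally have "h z = of_real (cmod (S z) ^ (2 * m)) * (cnj (S z) * f z)"
      by (simp add: h_def mult.assoc)
    then show ?thesis by (simp add: k)
  qed
  let ?C = "(3 * (real k)\<^sup>2) * 4 ^ k * (cmod d)\<^sup>2 :: real"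
  have "moment (2 * k) (\<lambda>z. S z + f z) \<le> (LINT z|circle_measure. cmod (S z) ^ (2 * k) +
      2 * k * Re (h z) + ?C * (cmod (S z) ^ (2 * k) + cmod (g z) ^ (2 * k)))"
    unfolding moment_def
  proof (intro integral_mono integrable_circle continuous_intros cont)
    fix z :: complex assume "z \<in> space circle_measure"
    then have z: "cmod z = 1" by simp
    then have fg: "cmod (f z) = cmod d * cmod (g z)"
      by (simp add: f_def norm_mult norm_power_int)
    \<comment> \<open>Inside the sum |S| + |f| the factor |d| is dropped; the separate factor |f|^2
      still supplies |d|^2.\<close>
    have fg': "cmod (f z) \<le> cmod (g z)"
      unfolding fg using assms(2) by (simp add: mult_left_le_one_le)
    have "(cmod (S z) + cmod (f z)) ^ (2 * k - 2) * (cmod (f z))\<^sup>2 \<le>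
        (cmod (S z) + cmod (g z)) ^ (2 * k - 2) * ((cmod d)\<^sup>2 * (cmod (S z) + cmod (g z))\<^sup>2)"
      unfolding fg power_mult_distrib using fg'[unfolded fg]
      by (intro mult_mono power_mono add_mono) auto
    also have "\<dots> = (cmod d)\<^sup>2 * (cmod (S z) + cmod (g z)) ^ (2 * k)"
      by (simp add: k power2_eq_square)
    also have "\<dots> \<le> (cmod d)\<^sup>2 * (2 ^ (2 * k) * (cmod (S z) ^ (2 * k) + cmod (g z) ^ (2 * k)))"
      by (intro mult_left_mono add_power_le) auto
    also have "(2::real) ^ (2 * k) = 4 ^ k"
      by (simp add: power_mult)
    finally have "(3 * (real k)\<^sup>2) * ((cmod (S z) + cmod (f z)) ^ (2 * k - 2) * (cmod (f z))\<^sup>2) \<le>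
        (3 * (real k)\<^sup>2) * ((cmod d)\<^sup>2 * (4 ^ k * (cmod (S z) ^ (2 * k) + cmod (g z) ^ (2 * k))))"
      by (intro mult_left_mono) auto
    then have *: "(3 * (real k)\<^sup>2) * ((cmod (S z) + cmod (f z)) ^ (2 * k - 2) * (cmod (f z))\<^sup>2) \<le>
        ?C * (cmod (S z) ^ (2 * k) + cmod (g z) ^ (2 * k))"
      by (simp only: mult_ac)
    show "cmod (S z + f z) ^ (2 * k) \<le> cmod (S z) ^ (2 * k) + 2 * k * Re (h z) +
        ?C * (cmod (S z) ^ (2 * k) + cmod (g z) ^ (2 * k))"
      using norm_add_even_power_le[OF assms(1), of "S z" "f z"] * unfolding Re_h by linarith
  qed
  also have "\<dots> = moment (2 * k) S + ?C * (moment (2 * k) S + moment (2 * k) g)"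
    unfolding moment_def using \<open>(LINT z|circle_measure. Re (h z)) = 0\<close>
    by (simp add: integrable_moment integrable_circle cont continuous_intros)
  finally show ?thesis by (simp add: f_def)
qed

section \<open>Lacunary sums\<close>

lemma lacunary_growth:
  fixes n :: "nat \<Rightarrow> nat"
  assumes "\<And>j. 2 * n j \<le> n (Suc j)"
  shows "2 ^ t * n j \<le> n (j + t)"
proof (induction t)
  case (Suc t)
  have "2 ^ Suc t * n j \<le> 2 * n (j + t)" using Suc.IH by simp
  also have "\<dots> \<le> n (j + Suc t)" using assms[of "j + t"] by simp
  finally show ?case .
qed simp

text \<open>Within a residue class mod $M$ the frequencies grow by a factor of at least $2^M \ge 4k$. The first
  order term in the expansion of the $2k$-th moment then has no constant Fourier coefficient.\<close>

lemma moment_residue_class_le: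
  fixes n :: "nat \<Rightarrow> nat" and c :: "nat \<Rightarrow> complex" and d :: "nat \<Rightarrow> int" and e :: int
    and g f :: "nat \<Rightarrow> complex \<Rightarrow> complex"
  defines "f \<equiv> \<lambda>j z. c j * z powi (e * int (n j)) * g j z"
  assumes k: "k \<ge> 1" and M: "4 * k \<le> 2 ^ M" and e: "\<bar>e\<bar> = 1"
    and n: "\<And>j. 1 \<le> n j" "\<And>j. 2 * n j \<le> n (Suc j)"
    and c: "\<And>j. cmod (c j) \<le> 1"
    and d: "\<And>j. 2 * d j \<le> int (n j)"
    and g: "\<And>j. trig_poly (- d j) (d j) (g j)"
    and f: "\<And>j. trig_poly (- int (n j)) (int (n j)) (f j)"
    and Q: "\<And>j. I \<le> j \<Longrightarrow> j < J \<Longrightarrow> moment (2 * k) (g j) \<le> Q"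
    and small: "(3 * (real k)\<^sup>2) * 4 ^ k * (\<Sum>j=I..<J. (cmod (c j))\<^sup>2) \<le> 1 / 2"
    and "0 \<le> Q"
  shows "i \<le> J \<Longrightarrow> moment (2 * k) (\<lambda>z. \<Sum>j | I \<le> j \<and> j < i \<and> j mod M = r. f j z) \<le>
    2 * ((3 * (real k)\<^sup>2) * 4 ^ k) * Q * (\<Sum>j=I..<i. (cmod (c j))\<^sup>2)"
proof (induction i)
  case 0
  show ?case using k by (simp add: moment_def power_0_left)
next
  case (Suc i)
  define C where "C = (3 * (real k)\<^sup>2) * 4 ^ k"
  define A where "A = (\<lambda>i. {j. I \<le> j \<and> j < i \<and> j mod M = r})"
  define S where "S = (\<lambda>i z. \<Sum>j\<in>A i. f j z)"
  define T where "T = (\<lambda>i. \<Sum>j=I..<i. (cmod (c j))\<^sup>2)"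
  have "C \<ge> 0" by (simp add: C_def)
  have finA: "finite (A i)" for i by (simp add: A_def)
  have IH: "moment (2 * k) (S i) \<le> 2 * C * Q * T i"
    using Suc by (simp add: S_def A_def T_def C_def)
  consider "i < I" | "I \<le> i" "i mod M \<noteq> r" | "I \<le> i" "i mod M = r" by linarith
  then have "moment (2 * k) (S (Suc i)) \<le> 2 * C * Q * T (Suc i)"
  proof cases
    case 1
    then have "A (Suc i) = {}" by (auto simp: A_def)
    with 1 k show ?thesis by (simp add: S_def T_def moment_def power_0_left)
  next
    case 2
    then have "A (Suc i) = A i" by (auto simp: A_def less_Suc_eq)
    then have "S (Suc i) = S i" by (simp add: S_def)
    moreover have "T i \<le> T (Suc i)" using 2 by (simp add: T_def)
    ultimately show ?thesis
      using IH mult_left_mono[of "T i" "T (Suc i)" "2 * C * Q"] \<open>0 \<le> C\<close> \<open>0 \<le> Q\<close> by simp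
  next
    case 3
    \<comment> \<open>Earlier members of the class precede \<open>i\<close> by at least
      \<open>M\<close> steps, so their frequencies are at most \<open>n i\<close> divided by 2^M.
      This bounds the degree of the whole partial sum.\<close>
    define D where "D = int (n i div 2 ^ M)"
    have "A (Suc i) = insert i (A i)" "i \<notin> A i" using 3 by (auto simp: A_def)
    then have S_Suc: "S (Suc i) = (\<lambda>z. S i z + c i * z powi (e * int (n i)) * g i z)"
      using finA by (simp add: S_def f_def add.commute)
    have S: "trig_poly (- D) D (S i)"
      unfolding S_def
    proof (rule trig_poly_sum)
      fix j assume "j \<in> A i"
      then have "j < i" "j mod M = i mod M" using 3 by (auto simp: A_def)
      then have "M dvd i - j" using mod_eq_dvd_iff_nat[of j i M] by simp
      then have "M \<le> i - j" using \<open>j < i\<close> by (intro dvd_imp_le) auto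
      then have "(2::nat) ^ M \<le> 2 ^ (i - j)" by simp
      then have "2 ^ M * n j \<le> n i"
        using order.trans[OF mult_le_mono1 lacunary_growth[of n, OF n(2)], of "2 ^ M" "i - j" j] \<open>j < i\<close>
        by simp
      then have "int (n j) \<le> D"
        unfolding D_def by (simp add: less_eq_div_iff_mult_less_eq mult.commute)
      then show "trig_poly (- D) D (f j)"
        by (intro trig_poly_mono[OF f]) auto
    qed
    have "4 * k * (n i div 2 ^ M) \<le> 2 ^ M * (n i div 2 ^ M)"
      by (intro mult_le_mono1 M)
    also have "\<dots> \<le> n i" by simp
    finally have "int (4 * k * (n i div 2 ^ M)) \<le> int (n i)" by (simp only: of_nat_le_iff)
    then have kD: "4 * (int k * D) \<le> int (n i)" by (simp add: D_def)
    moreover have "D \<ge> 0" by (simp add: D_def)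
    moreover have "D = 0 \<Longrightarrow> int k * D = 0" by simp
    \<comment> \<open>From 4kD <= n_i and 2d_i <= n_i follows (2k - 1)D + d_i <= n_i - D, which is
      strict for D > 0. For D = 0 the bound d_i <= n_i / 2 is already below n_i, as n_i >=
      1.\<close>
    ultimately have "2 * ((2 * int k - 1) * D + d i) < 2 * int (n i)"
      using d[of i] n(1)[of i] by (cases "D = 0") (auto simp: algebra_simps)
    then have w: "\<bar>e * int (n i)\<bar> > (2 * int k - 1) * D + d i"
      using e by (simp add: abs_mult)
    \<comment> \<open>By the smallness hypothesis the inductive bound on the partial sum is itself
      at most \<open>Q\<close>. The sum and the new factor \<open>g i\<close> then contribute at
      most \<open>2 * Q\<close> together, so the estimate does not compound along the
      induction.\<close>
    have "T i \<le> T J"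
      unfolding T_def using Suc.prems by (intro sum_mono2) auto
    then have "C * T i \<le> 1 / 2"
      using small mult_left_mono[of "T i" "T J" C] \<open>C \<ge> 0\<close> unfolding T_def C_def by linarith
    then have "2 * C * Q * T i \<le> Q"
      using mult_right_mono[of "C * T i" "1 / 2" Q] \<open>0 \<le> Q\<close> by (simp add: mult_ac)
    then have SQ: "moment (2 * k) (S i) + moment (2 * k) (g i) \<le> 2 * Q"
      using IH Q[of i] 3 Suc.prems by simp
    have "moment (2 * k) (S (Suc i)) \<le> moment (2 * k) (S i) +
        C * (cmod (c i))\<^sup>2 * (moment (2 * k) (S i) + moment (2 * k) (g i))"
      unfolding S_Suc C_def by (rule moment_add_lacunary_le[OF k c w S g])
    also have "\<dots> \<le> 2 * C * Q * T i + C * (cmod (c i))\<^sup>2 * (2 * Q)"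
      using \<open>C \<ge> 0\<close> by (intro add_mono IH mult_left_mono SQ) auto
    also have "\<dots> = 2 * C * Q * T (Suc i)"
      using 3 by (simp add: T_def algebra_simps)
    finally show ?thesis .
  qed
  then show ?case by (simp only: S_def A_def T_def C_def mem_Collect_eq)
qed

text \<open>The factor before the power is the constant for one residue class. Recombining 4k
  classes costs (4k)^(2k), and adding their equal bounds costs one more 4k.\<close>

definition lacunary_const :: "nat \<Rightarrow> real" where
  "lacunary_const k = 2 * ((3 * (real k)\<^sup>2) * 4 ^ k) * real (4 * k) ^ (2 * k + 1)"

lemma lacunary_const_pos: "k \<ge> 1 \<Longrightarrow> 0 < lacunary_const k"
  by (simp add: lacunary_const_def)

text \<open>The sum is split into residue classes of the index, each estimated on its own. The
  spectrum of the whole summand is assumed separately from that of \<open>g j\<close>, since the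
  bound on \<open>g j\<close> alone would only give degree 3 n_j / 2.\<close>

lemma moment_lacunary_sum_le:
  fixes n :: "nat \<Rightarrow> nat" and c :: "nat \<Rightarrow> complex" and d :: "nat \<Rightarrow> int" and e :: int
    and g :: "nat \<Rightarrow> complex \<Rightarrow> complex"
  assumes k: "k \<ge> 1" and e: "\<bar>e\<bar> = 1"
    and n: "\<And>j. 1 \<le> n j" "\<And>j. 2 * n j \<le> n (Suc j)"
    and c: "\<And>j. cmod (c j) \<le> 1"
    and d: "\<And>j. 2 * d j \<le> int (n j)"
    and g: "\<And>j. trig_poly (- d j) (d j) (g j)"
    and f: "\<And>j. trig_poly (- int (n j)) (int (n j)) (\<lambda>z. c j * z powi (e * int (n j)) * g j z)"
    and Q: "\<And>j. I \<le> j \<Longrightarrow> j < J \<Longrightarrow> moment (2 * k) (g j) \<le> Q" and "0 \<le> Q"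
    and small: "lacunary_const k * (\<Sum>j=I..<J. (cmod (c j))\<^sup>2) \<le> 1"
  shows "moment (2 * k) (\<lambda>z. \<Sum>j=I..<J. c j * z powi (e * int (n j)) * g j z) \<le>
    lacunary_const k * Q * (\<Sum>j=I..<J. (cmod (c j))\<^sup>2)"
proof -
  define f' where "f' = (\<lambda>j z. c j * z powi (e * int (n j)) * g j z)"
  define M where "M = 4 * k"
  define C where "C = (3 * (real k)\<^sup>2) * 4 ^ k"
  define T where "T = (\<Sum>j=I..<J. (cmod (c j))\<^sup>2)"
  have "M \<ge> 1" using k by (simp add: M_def)
  \<comment> \<open>As \<open>lacunary_const k\<close> is at least \<open>2 * C\<close>, the
    hypothesis \<open>small\<close> also yields the condition C T <= 1/2 needed inside each
    class.\<close>
  have "1 \<le> real (4 * k) ^ (2 * k + 1)"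
    using k by (intro one_le_power) auto
  then have "2 * C * 1 \<le> 2 * C * real (4 * k) ^ (2 * k + 1)"
    by (intro mult_left_mono) (auto simp: C_def)
  then have CK: "2 * C \<le> lacunary_const k"
    unfolding lacunary_const_def C_def[symmetric] by (simp only: mult_1_right)
  have "T \<ge> 0" by (simp add: T_def sum_nonneg)
  have CT: "C * T \<le> 1 / 2"
    using mult_right_mono[OF CK \<open>T \<ge> 0\<close>] small by (simp add: T_def)
  have cont: "continuous_on (sphere 0 1) (f' j)" for j
    unfolding f'_def by (rule trig_poly_continuous[OF f])
  have "(\<lambda>z. \<Sum>j=I..<J. f' j z) = (\<lambda>z. \<Sum>r<M. \<Sum>j | I \<le> j \<and> j < J \<and> j mod M = r. f' j z)"
  proof
    fix z
    have "(\<Sum>r<M. \<Sum>j\<in>{j \<in> {I..<J}. j mod M = r}. f' j z) = (\<Sum>j=I..<J. f' j z)"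
      by (rule sum.group) (use \<open>M \<ge> 1\<close> in auto)
    then show "(\<Sum>j=I..<J. f' j z) = (\<Sum>r<M. \<Sum>j | I \<le> j \<and> j < J \<and> j mod M = r. f' j z)"
      by simp
  qed
  then have "moment (2 * k) (\<lambda>z. \<Sum>j=I..<J. f' j z) =
      moment (2 * k) (\<lambda>z. \<Sum>r<M. \<Sum>j | I \<le> j \<and> j < J \<and> j mod M = r. f' j z)"
    by simp
  also have "\<dots> \<le> real (card {..<M}) ^ (2 * k) *
      (\<Sum>r<M. moment (2 * k) (\<lambda>z. \<Sum>j | I \<le> j \<and> j < J \<and> j mod M = r. f' j z))"
    using \<open>M \<ge> 1\<close> by (intro moment_sum_le continuous_on_sum cont) (auto simp: lessThan_empty_iff)
  also have "\<dots> \<le> real (card {..<M}) ^ (2 * k) * (\<Sum>r<M. 2 * C * Q * T)"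
  proof (intro mult_left_mono sum_mono)
    fix r
    have "4 * k \<le> 2 ^ M" unfolding M_def by (rule less_imp_le) (rule less_exp)
    then show "moment (2 * k) (\<lambda>z. \<Sum>j | I \<le> j \<and> j < J \<and> j mod M = r. f' j z) \<le> 2 * C * Q * T"
      unfolding f'_def C_def T_def
      by (rule moment_residue_class_le[where n = n and c = c and d = d and g = g, OF k _ e n c d g f Q])
         (use CT \<open>0 \<le> Q\<close> in \<open>auto simp: C_def T_def\<close>)
  qed auto
  also have "\<dots> = lacunary_const k * Q * T"
    by (simp add: lacunary_const_def C_def M_def)
  finally show ?thesis by (simp add: f'_def T_def)
qed

section \<open>The unnormalised lacunary recursion\<close>

text \<open>These are the entries of the first column of $\widetilde X_n$ after $j$ nontrivial steps, without
  the scalar factors $(1 - |\delta_i|^2)^{-1/2}$: dropping these makes the increments have pairwise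
  disjoint spectra.\<close>

fun lac_a lac_b :: "(nat \<Rightarrow> nat) \<Rightarrow> (nat \<Rightarrow> complex) \<Rightarrow> nat \<Rightarrow> complex \<Rightarrow> complex" where
  "lac_a n \<delta> 0 z = 1"
| "lac_b n \<delta> 0 z = 0"
| "lac_a n \<delta> (Suc j) z = lac_a n \<delta> j z + cnj (\<delta> j) * z powi (- int (n j)) * lac_b n \<delta> j z"
| "lac_b n \<delta> (Suc j) z = lac_b n \<delta> j z + \<delta> j * z powi int (n j) * lac_a n \<delta> j z"

text \<open>The last frequency used in the first \<open>j\<close> steps, which bounds the degrees of
  both entries. The value at 0 reflects that the initial entries are constants.\<close>

definition lac_deg :: "(nat \<Rightarrow> nat) \<Rightarrow> nat \<Rightarrow> int" where
  "lac_deg n j = (case j of 0 \<Rightarrow> 0 | Suc i \<Rightarrow> int (n i))"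

lemma lac_deg_le:
  assumes "\<And>j. 2 * n j \<le> n (Suc j)"
  shows "2 * lac_deg n j \<le> int (n j)"
  using assms[of "j - 1"] by (cases j) (auto simp: lac_deg_def)

text \<open>The spectra have to be tracked as one-sided. Two-sided bounds alone would let the degrees
  grow to about $2 n_j$, which is too much for $q = 2$.\<close>

lemma trig_poly_lac:
  assumes n: "\<And>j. 2 * n j \<le> n (Suc j)"
  shows "trig_poly (- lac_deg n j) 0 (lac_a n \<delta> j) \<and> trig_poly 0 (lac_deg n j) (lac_b n \<delta> j)"
proof (induction j)
  case 0
  have "lac_a n \<delta> 0 = (\<lambda>z. 1)" "lac_b n \<delta> 0 = (\<lambda>z. 0)" by auto
  then show ?case by (simp add: lac_deg_def trig_poly_const)
next
  case (Suc j)
  have d: "2 * lac_deg n j \<le> int (n j)" by (rule lac_deg_le[of n, OF n])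
  have d0: "0 \<le> lac_deg n j" by (simp add: lac_deg_def split: nat.split)
  have "lac_a n \<delta> (Suc j) = (\<lambda>z. lac_a n \<delta> j z + cnj (\<delta> j) * z powi (- int (n j)) * lac_b n \<delta> j z)"
    "lac_b n \<delta> (Suc j) = (\<lambda>z. lac_b n \<delta> j z + \<delta> j * z powi int (n j) * lac_a n \<delta> j z)"
    by auto
  \<comment> \<open>The shift by -n_j carries the spectrum of \<open>lac_b\<close> from
    [0, lac_deg n j] into [-n_j, 0], so the degree becomes n_j rather than n_j + lac_deg n j. The
    entry \<open>lac_b\<close> is treated symmetrically.\<close>
  moreover have "trig_poly (- int (n j)) 0
      (\<lambda>z. lac_a n \<delta> j z + cnj (\<delta> j) * z powi (- int (n j)) * lac_b n \<delta> j z)"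
    by (intro trig_poly.add trig_poly_mono[OF conjunct1[OF Suc.IH]]
        trig_poly_mono[OF trig_poly_mult_monom[OF conjunct2[OF Suc.IH]]]) (use d d0 in auto)
  moreover have "trig_poly 0 (int (n j))
      (\<lambda>z. lac_b n \<delta> j z + \<delta> j * z powi int (n j) * lac_a n \<delta> j z)"
    by (intro trig_poly.add trig_poly_mono[OF conjunct2[OF Suc.IH]]
        trig_poly_mono[OF trig_poly_mult_monom[OF conjunct1[OF Suc.IH]]]) (use d d0 in auto)
  ultimately show ?case by (simp add: lac_deg_def)
qed

text \<open>The recursion telescopes. The factors \<open>- 1\<close> and \<open>1\<close> are
  spelled out to match the sign \<open>e\<close> in \<open>moment_lacunary_sum_le\<close>.\<close>

lemma lac_diff_eq_sum:
  assumes "I \<le> J"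
  shows "lac_a n \<delta> J z - lac_a n \<delta> I z =
      (\<Sum>j=I..<J. cnj (\<delta> j) * z powi (- 1 * int (n j)) * lac_b n \<delta> j z)"
    and "lac_b n \<delta> J z - lac_b n \<delta> I z =
      (\<Sum>j=I..<J. \<delta> j * z powi (1 * int (n j)) * lac_a n \<delta> j z)"
  using assms by (induction J rule: dec_induct) (simp_all add: algebra_simps)

locale lacunary =
  fixes n :: "nat \<Rightarrow> nat" and \<delta> :: "nat \<Rightarrow> complex"
  assumes n_pos: "\<And>j. 1 \<le> n j"
    and n_Suc: "\<And>j. 2 * n j \<le> n (Suc j)"
    and \<delta>_less_1: "\<And>j. cmod (\<delta> j) < 1"
    and \<delta>_summable: "summable (\<lambda>j. (cmod (\<delta> j))\<^sup>2)"
begin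

abbreviation A where "A \<equiv> lac_a n \<delta>"
abbreviation B where "B \<equiv> lac_b n \<delta>"

lemma continuous_lac: "continuous_on (sphere 0 1) (A j)" "continuous_on (sphere 0 1) (B j)"
  using trig_poly_lac[of n, OF n_Suc] trig_poly_continuous by blast+

text \<open>The increments of each entry carry the other entry as the factor \<open>g\<close>, hence
  the joint bound \<open>Q\<close>. It is required only for indices below \<open>J\<close>, which
  makes the lemma usable in a strong induction on \<open>J\<close>.\<close>

lemma moment_lac_diff_le:
  assumes "k \<ge> 1" "I \<le> J" "0 \<le> Q"
    and Q: "\<And>j. I \<le> j \<Longrightarrow> j < J \<Longrightarrow> moment (2 * k) (A j) \<le> Q \<and> moment (2 * k) (B j) \<le> Q"
    and small: "lacunary_const k * (\<Sum>j=I..<J. (cmod (\<delta> j))\<^sup>2) \<le> 1"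
  shows "moment (2 * k) (\<lambda>z. A J z - A I z) \<le> lacunary_const k * Q * (\<Sum>j=I..<J. (cmod (\<delta> j))\<^sup>2)"
    and "moment (2 * k) (\<lambda>z. B J z - B I z) \<le> lacunary_const k * Q * (\<Sum>j=I..<J. (cmod (\<delta> j))\<^sup>2)"
proof -
  have d: "2 * lac_deg n j \<le> int (n j)" "0 \<le> lac_deg n j" for j
    using lac_deg_le[of n, OF n_Suc] by (auto simp: lac_deg_def split: nat.split)
  note AB = trig_poly_lac[of n _ \<delta>, OF n_Suc, THEN conjunct1] trig_poly_lac[of n _ \<delta>, OF n_Suc, THEN conjunct2]
  have "moment (2 * k) (\<lambda>z. \<Sum>j=I..<J. cnj (\<delta> j) * z powi (- 1 * int (n j)) * B j z) \<le>
      lacunary_const k * Q * (\<Sum>j=I..<J. (cmod (cnj (\<delta> j)))\<^sup>2)"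
  proof (rule moment_lacunary_sum_le[where n = n and d = "lac_deg n", OF assms(1) _ n_pos n_Suc _ d(1)])
    show "trig_poly (- lac_deg n j) (lac_deg n j) (B j)" for j
      by (rule trig_poly_mono[OF AB(2)]) (use d in auto)
    show "trig_poly (- int (n j)) (int (n j)) (\<lambda>z. cnj (\<delta> j) * z powi (- 1 * int (n j)) * B j z)" for j
      by (rule trig_poly_mono[OF trig_poly_mult_monom[OF AB(2)]]) (use d(1)[of j] d(2)[of j] in auto)
  qed (use \<delta>_less_1 assms in \<open>auto intro: less_imp_le\<close>)
  then show "moment (2 * k) (\<lambda>z. A J z - A I z) \<le> lacunary_const k * Q * (\<Sum>j=I..<J. (cmod (\<delta> j))\<^sup>2)"
    unfolding lac_diff_eq_sum[OF assms(2)] by simp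
  have "moment (2 * k) (\<lambda>z. \<Sum>j=I..<J. \<delta> j * z powi (1 * int (n j)) * A j z) \<le>
      lacunary_const k * Q * (\<Sum>j=I..<J. (cmod (\<delta> j))\<^sup>2)"
  proof (rule moment_lacunary_sum_le[where n = n and d = "lac_deg n", OF assms(1) _ n_pos n_Suc _ d(1)])
    show "trig_poly (- lac_deg n j) (lac_deg n j) (A j)" for j
      by (rule trig_poly_mono[OF AB(1)]) (use d in auto)
    show "trig_poly (- int (n j)) (int (n j)) (\<lambda>z. \<delta> j * z powi (1 * int (n j)) * A j z)" for j
      by (rule trig_poly_mono[OF trig_poly_mult_monom[OF AB(1)]]) (use d(1)[of j] d(2)[of j] in auto)
  qed (use \<delta>_less_1 assms in \<open>auto intro: less_imp_le\<close>)
  then show "moment (2 * k) (\<lambda>z. B J z - B I z) \<le> lacunary_const k * Q * (\<Sum>j=I..<J. (cmod (\<delta> j))\<^sup>2)"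
    unfolding lac_diff_eq_sum[OF assms(2)] by simp
qed

lemma tail_small:
  assumes "0 < \<epsilon>"
  obtains N where "\<And>I J. N \<le> I \<Longrightarrow> (\<Sum>j=I..<J. (cmod (\<delta> j))\<^sup>2) < \<epsilon>"
proof -
  obtain N where "\<forall>I\<ge>N. \<forall>J. norm (\<Sum>j=I..<J. (cmod (\<delta> j))\<^sup>2) < \<epsilon>"
    using \<delta>_summable assms unfolding summable_Cauchy by blast
  then have "(\<Sum>j=I..<J. (cmod (\<delta> j))\<^sup>2) < \<epsilon>" if "N \<le> I" for I J
    using that by (auto simp: sum_nonneg)
  then show ?thesis by (rule that)
qed

text \<open>A bootstrap over a tail: if all moments from \<open>I\<close> up to before
  \<open>J\<close> are at most \<open>Q\<close>, the increment from \<open>I\<close> to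
  \<open>J\<close> is a small multiple of \<open>Q\<close>, and the bound passes to
  \<open>J\<close>.\<close>

lemma moment_lac_bounded:
  assumes "k \<ge> 1"
  obtains Q where "0 \<le> Q" "\<And>j. moment (2 * k) (A j) \<le> Q" "\<And>j. moment (2 * k) (B j) \<le> Q"
proof -
  define K where "K = lacunary_const k"
  define P where "P = (\<lambda>j. moment (2 * k) (A j) + moment (2 * k) (B j))"
  have "K > 0" unfolding K_def by (rule lacunary_const_pos[OF assms])
  have P0: "0 \<le> P j" for j by (simp add: P_def)
  \<comment> \<open>The factor 4^k is the cost of \<open>moment_add_le\<close> at exponent 2k. With
    this threshold the increment contributes at most Q/2, and \<open>Q\<close> is chosen below so
    that the starting moments contribute at most the other half.\<close>
  have "0 < 1 / (2 * 4 ^ k * K)" using \<open>K > 0\<close> by simp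
  then obtain I where I: "\<And>I' J. I \<le> I' \<Longrightarrow> (\<Sum>j=I'..<J. (cmod (\<delta> j))\<^sup>2) < 1 / (2 * 4 ^ k * K)"
    using tail_small by blast
  have small: "4 ^ k * (K * (\<Sum>j=I..<J. (cmod (\<delta> j))\<^sup>2)) \<le> 1 / 2" for J
    using I[OF order.refl, of J] \<open>K > 0\<close> by (simp add: field_simps)
  define Q where "Q = 2 * 4 ^ k * P I"
  have "0 \<le> Q" by (simp add: Q_def P0)
  have tail: "moment (2 * k) (A J) \<le> Q \<and> moment (2 * k) (B J) \<le> Q" if "I \<le> J" for J
    using that
  proof (induction J rule: less_induct)
    case (less J)
    let ?T = "\<Sum>j=I..<J. (cmod (\<delta> j))\<^sup>2"
    have "K * ?T \<le> 1 * (K * ?T)" by simp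
    also have "\<dots> \<le> 4 ^ k * (K * ?T)"
      using \<open>K > 0\<close> by (intro mult_right_mono) (auto simp: sum_nonneg)
    finally have "K * ?T \<le> 1" using small[of J] by linarith
    then have diff: "moment (2 * k) (\<lambda>z. A J z - A I z) \<le> K * Q * ?T"
      "moment (2 * k) (\<lambda>z. B J z - B I z) \<le> K * Q * ?T"
      unfolding K_def using less \<open>0 \<le> Q\<close> by (intro moment_lac_diff_le[OF assms]; simp)+
    have "4 ^ k * (K * Q * ?T) \<le> Q / 2"
      using mult_right_mono[OF small[of J] \<open>0 \<le> Q\<close>] by (simp add: mult_ac)
    have 4: "(2::real) ^ (2 * k) = 4 ^ k" by (simp add: power_mult)
    have half: "4 ^ k * (x + y) \<le> Q" if "x \<le> P I" "y \<le> K * Q * ?T" for x y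
    proof -
      have "4 ^ k * (x + y) \<le> 4 ^ k * (P I + K * Q * ?T)"
        using that by (intro mult_left_mono add_mono) auto
      also have "\<dots> \<le> Q"
        using \<open>4 ^ k * (K * Q * ?T) \<le> Q / 2\<close> by (simp add: Q_def distrib_left)
      finally show ?thesis .
    qed
    have "moment (2 * k) (\<lambda>z. A I z + (A J z - A I z)) \<le>
        4 ^ k * (moment (2 * k) (A I) + moment (2 * k) (\<lambda>z. A J z - A I z))"
      unfolding 4[symmetric] by (intro moment_add_le continuous_intros continuous_lac)
    also have "\<dots> \<le> Q" by (rule half) (use diff in \<open>auto simp: P_def\<close>)
    finally have a: "moment (2 * k) (A J) \<le> Q" by simp
    have "moment (2 * k) (\<lambda>z. B I z + (B J z - B I z)) \<le>
        4 ^ k * (moment (2 * k) (B I) + moment (2 * k) (\<lambda>z. B J z - B I z))"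
      unfolding 4[symmetric] by (intro moment_add_le continuous_intros continuous_lac)
    also have "\<dots> \<le> Q" by (rule half) (use diff in \<open>auto simp: P_def\<close>)
    finally show ?case using a by simp
  qed
  \<comment> \<open>The finitely many indices before \<open>I\<close> are absorbed by adding all
    their moments to the bound.\<close>
  have "moment (2 * k) (A j) \<le> Q + (\<Sum>i<I. P i) \<and> moment (2 * k) (B j) \<le> Q + (\<Sum>i<I. P i)" for j
  proof (cases "I \<le> j")
    case True
    then show ?thesis using tail[OF True] sum_nonneg[of "{..<I}" P] P0 by fastforce
  next
    case False
    then have "P j \<le> (\<Sum>i<I. P i)" by (intro member_le_sum) (auto simp: P0)
    moreover have "moment (2 * k) (A j) \<le> P j" "moment (2 * k) (B j) \<le> P j"
      by (simp_all add: P_def)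
    ultimately show ?thesis using \<open>0 \<le> Q\<close> by linarith
  qed
  moreover have "0 \<le> Q + (\<Sum>i<I. P i)" using \<open>0 \<le> Q\<close> P0 by (simp add: sum_nonneg)
  ultimately show ?thesis using that by blast
qed

lemma moment_lac_Cauchy:
  assumes "k \<ge> 1" "0 < \<epsilon>"
  obtains N where "\<And>I J. N \<le> I \<Longrightarrow> I \<le> J \<Longrightarrow> moment (2 * k) (\<lambda>z. A J z - A I z) < \<epsilon>"
    "\<And>I J. N \<le> I \<Longrightarrow> I \<le> J \<Longrightarrow> moment (2 * k) (\<lambda>z. B J z - B I z) < \<epsilon>"
proof -
  obtain Q where Q: "0 \<le> Q" "\<And>j. moment (2 * k) (A j) \<le> Q" "\<And>j. moment (2 * k) (B j) \<le> Q"
    using moment_lac_bounded[OF assms(1)] by blast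
  define K where "K = lacunary_const k"
  have "K > 0" unfolding K_def by (rule lacunary_const_pos[OF assms(1)])
  \<comment> \<open>The 1 in the minimum secures the smallness hypothesis of
    \<open>moment_lac_diff_le\<close>, the quotient the final bound; \<open>Q + 1\<close> avoids
    division by zero.\<close>
  define \<eta> where "\<eta> = min 1 (\<epsilon> / (Q + 1)) / K"
  have "\<eta> > 0" using \<open>K > 0\<close> assms Q by (simp add: \<eta>_def)
  obtain N where N: "\<And>I J. N \<le> I \<Longrightarrow> (\<Sum>j=I..<J. (cmod (\<delta> j))\<^sup>2) < \<eta>"
    using tail_small[OF \<open>\<eta> > 0\<close>] by blast
  have small: "lacunary_const k * (\<Sum>j=I..<J. (cmod (\<delta> j))\<^sup>2) \<le> 1"
    and bound: "lacunary_const k * Q * (\<Sum>j=I..<J. (cmod (\<delta> j))\<^sup>2) < \<epsilon>" if "N \<le> I" for I J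
  proof -
    let ?T = "\<Sum>j=I..<J. (cmod (\<delta> j))\<^sup>2"
    have KT: "K * ?T < min 1 (\<epsilon> / (Q + 1))"
      using N[OF that, of J] \<open>K > 0\<close> unfolding \<eta>_def by (simp add: pos_less_divide_eq mult.commute)
    then show "lacunary_const k * ?T \<le> 1" by (simp add: K_def)
    have "0 \<le> ?T" by (simp add: sum_nonneg)
    have "K * Q * ?T \<le> (Q + 1) * (K * ?T)"
      using \<open>K > 0\<close> \<open>0 \<le> ?T\<close> by (simp add: algebra_simps)
    also have "\<dots> < (Q + 1) * (\<epsilon> / (Q + 1))"
      using KT Q(1) by (intro mult_strict_left_mono) auto
    also have "\<dots> = \<epsilon>" using Q(1) by simp
    finally show "lacunary_const k * Q * ?T < \<epsilon>" by (simp add: K_def)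
  qed
  show ?thesis
  proof (rule that[of N])
    fix I J assume IJ: "N \<le> I" "I \<le> J"
    show "moment (2 * k) (\<lambda>z. A J z - A I z) < \<epsilon>"
      by (rule le_less_trans[OF moment_lac_diff_le(1)[OF assms(1) IJ(2) Q(1) _ small[OF IJ(1)]] bound[OF IJ(1)]])
         (use Q in auto)
    show "moment (2 * k) (\<lambda>z. B J z - B I z) < \<epsilon>"
      by (rule le_less_trans[OF moment_lac_diff_le(2)[OF assms(1) IJ(2) Q(1) _ small[OF IJ(1)]] bound[OF IJ(1)]])
         (use Q in auto)
  qed
qed

end

section \<open>Passage to $L^p$\<close>

text \<open>Below the threshold the first summand dominates, above it the second, because
  \<open>r - p\<close> is not positive. On a finite measure space this replaces Hoelder's
  inequality.\<close>

lemma powr_le_add_powr: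
  fixes x :: real
  assumes "0 \<le> x" "0 < \<eta>" "0 \<le> r" "r \<le> p"
  shows "x powr r \<le> \<eta> powr r + \<eta> powr (r - p) * x powr p"
proof (cases "x \<le> \<eta>")
  case True
  then have "x powr r \<le> \<eta> powr r" using assms by (intro powr_mono2) auto
  then show ?thesis by (simp add: add_increasing2)
next
  case False
  then have "x powr r = x powr (r - p) * x powr p"
    using assms by (simp flip: powr_add)
  also have "\<dots> \<le> \<eta> powr (r - p) * x powr p"
    using False assms by (intro mult_right_mono powr_mono2') auto
  finally show ?thesis by (simp add: add_increasing)
qed

lemma (in finite_measure) Lp_space_antimono:
  assumes h: "h \<in> Lp_space p M" and "0 \<le> r" "r \<le> p"
  shows "h \<in> Lp_space r M"
proof -
  have [measurable]: "h \<in> borel_measurable M" and int: "integrable M (\<lambda>x. cmod (h x) powr p)"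
    using h by (auto simp: Lp_space_def)
  have "integrable M (\<lambda>x. cmod (h x) powr r)"
  proof (rule Bochner_Integration.integrable_bound)
    show "integrable M (\<lambda>x. 1 powr r + 1 powr (r - p) * cmod (h x) powr p)"
      using int by simp
    have "norm (cmod (h x) powr r) \<le> norm (1 powr r + 1 powr (r - p) * cmod (h x) powr p)" for x
      using powr_le_add_powr[of "cmod (h x)" 1 r p] assms by simp
    then show "AE x in M. norm (cmod (h x) powr r) \<le>
        norm (1 powr r + 1 powr (r - p) * cmod (h x) powr p)"
      by simp
  qed measurable
  then show ?thesis by (simp add: Lp_space_def)
qed

lemma (in finite_measure) integral_powr_small:
  fixes r p e :: real
  assumes "0 < e" "0 < r" "r \<le> p"
  shows "\<exists>d>0. \<forall>h\<in>Lp_space p M. (\<integral>x. cmod (h x) powr p \<partial>M) < d \<longrightarrow>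
    (\<integral>x. cmod (h x) powr r \<partial>M) < e"
proof -
  define m where "m = measure M (space M)"
  \<comment> \<open>The threshold makes the constant term contribute at most e/2;
    \<open>m + 1\<close> keeps the quotient meaningful for a null measure.\<close>
  define \<eta> where "\<eta> = (e / (2 * (m + 1))) powr (1 / r)"
  have "m \<ge> 0" by (simp add: m_def)
  have "\<eta> > 0" using assms \<open>m \<ge> 0\<close> by (simp add: \<eta>_def)
  have \<eta>: "\<eta> powr r * (m + 1) = e / 2"
    using assms \<open>m \<ge> 0\<close> by (simp add: \<eta>_def powr_powr field_simps)
  have "(\<integral>x. cmod (h x) powr r \<partial>M) < e"
    if h: "h \<in> Lp_space p M" and d: "(\<integral>x. cmod (h x) powr p \<partial>M) < e / 2 / \<eta> powr (r - p)" for h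
  proof -
    have "integrable M (\<lambda>x. cmod (h x) powr r)"
      using Lp_space_antimono[OF h, of r] assms by (simp add: Lp_space_def)
    moreover have int: "integrable M (\<lambda>x. cmod (h x) powr p)"
      using h by (simp add: Lp_space_def)
    ultimately have "(\<integral>x. cmod (h x) powr r \<partial>M) \<le>
        (\<integral>x. \<eta> powr r + \<eta> powr (r - p) * cmod (h x) powr p \<partial>M)"
      using powr_le_add_powr \<open>\<eta> > 0\<close> assms by (intro integral_mono) auto
    also have "\<dots> = m * \<eta> powr r + \<eta> powr (r - p) * (\<integral>x. cmod (h x) powr p \<partial>M)"
      using int by (simp add: m_def)
    also have "\<dots> < m * \<eta> powr r + e / 2"
      using d \<open>\<eta> > 0\<close> by (simp add: pos_less_divide_eq mult_ac)
    also have "\<dots> \<le> \<eta> powr r * (m + 1) + e / 2" by (simp add: algebra_simps)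
    also have "\<dots> = e" using \<eta> by simp
    finally show ?thesis .
  qed
  moreover have "0 < e / 2 / \<eta> powr (r - p)" using assms \<open>\<eta> > 0\<close> by simp
  ultimately show ?thesis by blast
qed

lemma Lp_space_diff:
  assumes "f \<in> Lp_space p M" "g \<in> Lp_space p M" "0 \<le> p"
  shows "(\<lambda>x. f x - g x) \<in> Lp_space p M"
proof -
  have [measurable]: "f \<in> borel_measurable M" "g \<in> borel_measurable M"
    using assms by (auto simp: Lp_space_def)
  have le: "cmod (f x - g x) powr p \<le> 2 powr p * (cmod (f x) powr p + cmod (g x) powr p)" for x
  proof -
    have "cmod (f x - g x) powr p \<le> (2 * max (cmod (f x)) (cmod (g x))) powr p"
      using norm_triangle_ineq4[of "f x" "g x"] assms(3) by (intro powr_mono2) (auto simp: max_def)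
    also have "\<dots> \<le> 2 powr p * (cmod (f x) powr p + cmod (g x) powr p)"
      by (auto simp: powr_mult max_def)
    finally show ?thesis .
  qed
  have "integrable M (\<lambda>x. cmod (f x - g x) powr p)"
  proof (rule Bochner_Integration.integrable_bound)
    show "integrable M (\<lambda>x. 2 powr p * (cmod (f x) powr p + cmod (g x) powr p))"
      using assms by (auto simp: Lp_space_def)
    show "AE x in M. norm (cmod (f x - g x) powr p)
        \<le> norm (2 powr p * (cmod (f x) powr p + cmod (g x) powr p))"
      using le by (auto intro: order.trans)
  qed measurable
  then show ?thesis by (simp add: Lp_space_def)
qed

text \<open>The Riesz-Fischer argument: on a finite measure space the sequence is also Cauchy in
  L^1, so a subsequence converges almost everywhere, and Fatou's lemma in the second index turns the
  Cauchy estimate into one against the limit.\<close>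

lemma (in finite_measure) Lp_Cauchy_imp_limit:
  fixes f :: "nat \<Rightarrow> 'a \<Rightarrow> complex"
  assumes p: "1 \<le> p" and f: "\<And>i. f i \<in> Lp_space p M"
    and Cauchy: "\<And>e. 0 < e \<Longrightarrow> \<exists>N. \<forall>i\<ge>N. \<forall>j\<ge>N. (\<integral>x. cmod (f i x - f j x) powr p \<partial>M) < e"
  shows "\<exists>g. Lp_limit p M f g"
proof -
  have [measurable]: "f i \<in> borel_measurable M" for i
    using f by (auto simp: Lp_space_def)
  have diff: "integrable M (\<lambda>x. cmod (f i x - f j x) powr p)" for i j
    using Lp_space_diff[OF f f] p by (auto simp: Lp_space_def)
  have int1: "integrable M (f i)" for i
  proof -
    have "integrable M (\<lambda>x. cmod (f i x))"
      using Lp_space_antimono[OF f, of 1] p by (simp add: Lp_space_def)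
    then show ?thesis by (simp add: integrable_norm_iff)
  qed
  have "\<exists>N. \<forall>i\<ge>N. \<forall>j\<ge>N. (\<integral>x. norm (f i x - f j x) \<partial>M) < e" if "e > 0" for e
  proof -
    obtain d where "0 < d" and d: "\<forall>h\<in>Lp_space p M. (\<integral>x. cmod (h x) powr p \<partial>M) < d \<longrightarrow>
        (\<integral>x. cmod (h x) powr 1 \<partial>M) < e"
      using integral_powr_small[OF \<open>e > 0\<close> zero_less_one p] by blast
    obtain N where N: "\<forall>i\<ge>N. \<forall>j\<ge>N. (\<integral>x. cmod (f i x - f j x) powr p \<partial>M) < d"
      using Cauchy[OF \<open>0 < d\<close>] by blast
    have "(\<integral>x. norm (f i x - f j x) \<partial>M) < e" if "N \<le> i" "N \<le> j" for i j
      using d[rule_format, of "\<lambda>x. f i x - f j x"] N that Lp_space_diff[OF f f, of i j] p by simp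
    then show ?thesis by blast
  qed
  then obtain r where r: "strict_mono r" "AE x in M. Cauchy (\<lambda>i. f (r i) x)"
    using cauchy_L1_AE_cauchy_subseq[of M f, OF int1] by blast
  \<comment> \<open>Where the subsequence diverges, \<open>lim\<close> takes an unspecified value;
    this happens only on a null set.\<close>
  define g where "g = (\<lambda>x. lim (\<lambda>i. f (r i) x))"
  have [measurable]: "g \<in> borel_measurable M"
    unfolding g_def by (rule borel_measurable_lim_metric) measurable
  have lim: "AE x in M. (\<lambda>i. f (r i) x) \<longlonglongrightarrow> g x"
    using r(2) by eventually_elim (auto simp: g_def Cauchy_convergent_iff convergent_LIMSEQ_iff)
  have key: "\<exists>N. \<forall>i\<ge>N. integrable M (\<lambda>x. cmod (f i x - g x) powr p) \<and>
      (\<integral>x. cmod (f i x - g x) powr p \<partial>M) \<le> e" if "e > 0" for e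
  proof -
    obtain N where N: "\<forall>i\<ge>N. \<forall>j\<ge>N. (\<integral>x. cmod (f i x - f j x) powr p \<partial>M) < e"
      using Cauchy[OF \<open>e > 0\<close>] by blast
    have "integrable M (\<lambda>x. cmod (f i x - g x) powr p) \<and>
      (\<integral>x. cmod (f i x - g x) powr p \<partial>M) \<le> e" if "N \<le> i" for i
    proof -
      have "(\<integral>\<^sup>+x. ennreal (cmod (f i x - g x) powr p) \<partial>M) =
          (\<integral>\<^sup>+x. liminf (\<lambda>m. ennreal (cmod (f i x - f (r m) x) powr p)) \<partial>M)"
      proof (rule nn_integral_cong_AE)
        show "AE x in M. ennreal (cmod (f i x - g x) powr p) =
            liminf (\<lambda>m. ennreal (cmod (f i x - f (r m) x) powr p))"
          using lim
        proof eventually_elim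
          case (elim x)
          have "(\<lambda>m. ennreal (cmod (f i x - f (r m) x) powr p))
              \<longlonglongrightarrow> ennreal (cmod (f i x - g x) powr p)"
            using p by (intro tendsto_ennrealI tendsto_powr' tendsto_intros elim) auto
          then show ?case by (intro lim_imp_Liminf[symmetric]) auto
        qed
      qed
      also have "\<dots> \<le> liminf (\<lambda>m. \<integral>\<^sup>+x. ennreal (cmod (f i x - f (r m) x) powr p) \<partial>M)"
        by (rule nn_integral_liminf) measurable
      also have "\<dots> \<le> limsup (\<lambda>m. \<integral>\<^sup>+x. ennreal (cmod (f i x - f (r m) x) powr p) \<partial>M)"
        by (intro Liminf_le_Limsup) simp
      also have "\<dots> \<le> ennreal e"
      proof (rule Limsup_bounded)
        have "(\<integral>\<^sup>+x. ennreal (cmod (f i x - f (r m) x) powr p) \<partial>M) \<le> ennreal e" if "N \<le> m" for m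
        proof -
          have "N \<le> r m" using seq_suble[OF r(1), of m] that by linarith
          then have "(\<integral>x. cmod (f i x - f (r m) x) powr p \<partial>M) \<le> e"
            using N \<open>N \<le> i\<close> by (auto intro: less_imp_le)
          then show ?thesis
            by (subst nn_integral_eq_integral) (auto simp: diff ennreal_leI)
        qed
        then show "\<forall>\<^sub>F m in sequentially.
            (\<integral>\<^sup>+x. ennreal (cmod (f i x - f (r m) x) powr p) \<partial>M) \<le> ennreal e"
          by (auto simp: eventually_sequentially)
      qed
      finally have le: "(\<integral>\<^sup>+x. ennreal (cmod (f i x - g x) powr p) \<partial>M) \<le> ennreal e" .
      then have int: "integrable M (\<lambda>x. cmod (f i x - g x) powr p)"
        by (intro integrableI_nonneg) (auto intro: le_less_trans)
      with le \<open>e > 0\<close> show ?thesis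
        by (subst (asm) nn_integral_eq_integral) auto
    qed
    then show ?thesis by blast
  qed
  obtain N where "integrable M (\<lambda>x. cmod (f N x - g x) powr p)"
    using key[of 1] by auto
  \<comment> \<open>Membership of \<open>g\<close> follows from writing it as f_N - (f_N -
    g).\<close>
  then have "(\<lambda>x. f N x - g x) \<in> Lp_space p M" by (simp add: Lp_space_def)
  from Lp_space_diff[OF f[of N] this] p have "g \<in> Lp_space p M" by simp
  moreover have "(\<lambda>i. \<integral>x. cmod (f i x - g x) powr p \<partial>M) \<longlonglongrightarrow> 0"
  proof (rule LIMSEQ_I)
    fix e :: real assume "0 < e"
    then obtain N where "\<forall>i\<ge>N. (\<integral>x. cmod (f i x - g x) powr p \<partial>M) \<le> e / 2"
      using key[of "e / 2"] by auto
    then show "\<exists>N. \<forall>i\<ge>N. norm ((\<integral>x. cmod (f i x - g x) powr p \<partial>M) - 0) < e"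
      using \<open>0 < e\<close> by (intro exI[of _ N]) fastforce
  qed
  then have "(\<lambda>i. Lp_norm p M (\<lambda>x. f i x - g x)) \<longlonglongrightarrow> 0"
    unfolding Lp_norm_def using p
    by (intro tendsto_zero_powrI[where b = "1 / p"]) auto
  ultimately show ?thesis using f unfolding Lp_limit_def by blast
qed

lemma continuous_Lp_space_circle:
  assumes "continuous_on (sphere 0 1) f" "0 < p"
  shows "f \<in> Lp_space p circle_measure"
  unfolding Lp_space_def mem_Collect_eq using assms
  by (intro conjI measurable_circle integrable_circle continuous_on_powr' continuous_intros) auto

lemma moment_eq_powr:
  "m > 0 \<Longrightarrow> moment m f = (LINT z|circle_measure. cmod (f z) powr real m)"
  unfolding moment_def
  by (intro Bochner_Integration.integral_cong refl) (simp add: powr_realpow')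

text \<open>The Cauchy property descends from the integer exponent \<open>m\<close> to
  \<open>p\<close>, since the measure is finite; completeness of L^p then gives the limit.\<close>

lemma moment_Cauchy_imp_Lp_limit:
  fixes f :: "nat \<Rightarrow> complex \<Rightarrow> complex"
  assumes "1 \<le> p" "p \<le> real m" and cont: "\<And>i. continuous_on (sphere 0 1) (f i)"
    and Cauchy: "\<And>e. 0 < e \<Longrightarrow> \<exists>N. \<forall>i\<ge>N. \<forall>j\<ge>i. moment m (\<lambda>z. f j z - f i z) < e"
  shows "\<exists>g. Lp_limit p circle_measure f g"
proof (rule finite_measure.Lp_Cauchy_imp_limit[OF finite_measure_circle assms(1)])
  show "f i \<in> Lp_space p circle_measure" for i
    using cont assms(1) by (intro continuous_Lp_space_circle) auto
  fix e :: real assume "0 < e"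
  have "m > 0" using assms by (cases m) auto
  obtain d where "0 < d" and d: "\<forall>h\<in>Lp_space m circle_measure.
      (LINT x|circle_measure. cmod (h x) powr m) < d \<longrightarrow>
      (LINT x|circle_measure. cmod (h x) powr p) < e"
    using finite_measure.integral_powr_small[OF finite_measure_circle \<open>0 < e\<close>, of p m] assms(1,2)
    by force
  obtain N where N: "\<forall>i\<ge>N. \<forall>j\<ge>i. moment m (\<lambda>z. f j z - f i z) < d"
    using Cauchy[OF \<open>0 < d\<close>] by blast
  have "moment m (\<lambda>z. f i z - f j z) < d" if "N \<le> i" "N \<le> j" for i j
    using N that moment_cong[of "\<lambda>z. f i z - f j z" "\<lambda>z. f j z - f i z" m, OF norm_minus_commute] by (metis nat_le_linear)
  moreover have "(\<lambda>z. f i z - f j z) \<in> Lp_space m circle_measure" for i j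
    using cont \<open>m > 0\<close> by (intro continuous_Lp_space_circle continuous_intros) auto
  ultimately have "(LINT z|circle_measure. cmod (f i z - f j z) powr p) < e"
    if "N \<le> i" "N \<le> j" for i j
    using d[rule_format, of "\<lambda>z. f i z - f j z"] that \<open>m > 0\<close> by (simp add: moment_eq_powr)
  then show "\<exists>N. \<forall>i\<ge>N. \<forall>j\<ge>N. (LINT z|circle_measure. cmod (f i z - f j z) powr p) < e"
    by blast
qed

text \<open>The difference splits as c_j (f_j - f_i) + (c_j - c_i) f_i. Boundedness of
  \<open>c\<close> controls the first part, the uniform moment bound \<open>Q\<close> the
  second.\<close>

lemma moment_Cauchy_mult:
  fixes f :: "nat \<Rightarrow> complex \<Rightarrow> complex" and c :: "nat \<Rightarrow> complex"
  assumes "0 < m" "convergent c" and cont: "\<And>i. continuous_on (sphere 0 1) (f i)"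
    and Q: "\<And>i. moment m (f i) \<le> Q"
    and Cauchy: "\<And>e. 0 < e \<Longrightarrow> \<exists>N. \<forall>i\<ge>N. \<forall>j\<ge>i. moment m (\<lambda>z. f j z - f i z) < e"
    and "0 < e"
  shows "\<exists>N. \<forall>i\<ge>N. \<forall>j\<ge>i. moment m (\<lambda>z. c j * f j z - c i * f i z) < e"
proof -
  have "Q \<ge> 0" using Q[of 0] moment_nonneg[of m "f 0"] by linarith
  obtain B where B: "B > 0" "\<And>i. cmod (c i) \<le> B"
    using convergent_imp_Bseq[OF assms(2)] by (auto simp: Bseq_def)
  define \<eta> where "\<eta> = e / (2 * 2 ^ m)"
  have "\<eta> > 0" using \<open>0 < e\<close> by (simp add: \<eta>_def)
  obtain N where N: "\<forall>i\<ge>N. \<forall>j\<ge>i. moment m (\<lambda>z. f j z - f i z) < \<eta> / B ^ m"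
    using Cauchy[of "\<eta> / B ^ m"] \<open>\<eta> > 0\<close> B by auto
  \<comment> \<open>Capping at 1 gives \<theta>^m <= \<theta>, so no \<open>m\<close>-th root has to
    be taken.\<close>
  define \<theta> where "\<theta> = min 1 (\<eta> / (Q + 1))"
  have "\<theta> > 0" "\<theta> \<le> 1" using \<open>\<eta> > 0\<close> \<open>Q \<ge> 0\<close> by (auto simp: \<theta>_def)
  obtain N' where N': "\<forall>i\<ge>N'. \<forall>j\<ge>N'. cmod (c i - c j) < \<theta>"
    using convergent_Cauchy[OF assms(2)] \<open>\<theta> > 0\<close> unfolding Cauchy_def dist_norm by blast
  have "moment m (\<lambda>z. c j * f j z - c i * f i z) < e" if "max N N' \<le> i" "i \<le> j" for i j
  proof -
    have "moment m (\<lambda>z. c j * f j z - c i * f i z) =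
        moment m (\<lambda>z. c j * (f j z - f i z) + (c j - c i) * f i z)"
      by (simp add: algebra_simps)
    also have "\<dots> \<le> 2 ^ m * (moment m (\<lambda>z. c j * (f j z - f i z)) + moment m (\<lambda>z. (c j - c i) * f i z))"
      by (intro moment_add_le continuous_intros cont)
    also have "\<dots> < 2 ^ m * (\<eta> + \<eta>)"
    proof (intro mult_strict_left_mono add_less_le_mono)
      have "cmod (c j) ^ m * moment m (\<lambda>z. f j z - f i z) \<le> B ^ m * moment m (\<lambda>z. f j z - f i z)"
        using B by (intro mult_right_mono power_mono) auto
      also have "\<dots> < B ^ m * (\<eta> / B ^ m)"
        using N that B by (intro mult_strict_left_mono) auto
      finally show "moment m (\<lambda>z. c j * (f j z - f i z)) < \<eta>"
        using B by (simp add: moment_scale)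
      have "cmod (c j - c i) \<le> \<theta>" using N' that by (auto intro: less_imp_le)
      then have "cmod (c j - c i) ^ m \<le> \<theta> ^ m" by (intro power_mono) auto
      also have "\<dots> \<le> \<theta>"
        using power_decreasing[of 1 m \<theta>] \<open>0 < m\<close> \<open>\<theta> > 0\<close> \<open>\<theta> \<le> 1\<close> by simp
      also have "\<dots> \<le> \<eta> / (Q + 1)" by (simp add: \<theta>_def)
      finally have "cmod (c j - c i) ^ m * moment m (f i) \<le> \<eta> / (Q + 1) * (Q + 1)"
        using Q[of i] \<open>Q \<ge> 0\<close> \<open>\<eta> > 0\<close> by (intro mult_mono) auto
      then show "moment m (\<lambda>z. (c j - c i) * f i z) \<le> \<eta>"
        using \<open>Q \<ge> 0\<close> by (simp add: moment_scale)
    qed simp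
    also have "\<dots> = e" by (simp add: \<eta>_def)
    finally show ?thesis .
  qed
  then show ?thesis by blast
qed

lemma Lp_limit_compose:
  assumes "Lp_limit p M f g" "filterlim J at_top sequentially"
  shows "Lp_limit p M (\<lambda>N. f (J N)) g"
  using assms filterlim_compose[of "\<lambda>N. Lp_norm p M (\<lambda>x. f N x - g x)" "nhds 0" at_top J]
  by (auto simp: Lp_limit_def)

section \<open>The normalised transform\<close>

context lacunary
begin

definition step_norm :: "nat \<Rightarrow> real" where
  "step_norm j = sqrt (1 - (cmod (\<delta> j))\<^sup>2)"

definition norm_factor :: "nat \<Rightarrow> real" where
  "norm_factor J = (\<Prod>j<J. 1 / step_norm j)"

text \<open>Square summability makes the product of 1 - |\<delta>_j|^2 converge absolutely. No
  factor vanishes, so the limit is nonzero and the reciprocal square root passes to the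
  limit.\<close>

lemma convergent_norm_factor: "convergent norm_factor"
proof -
  let ?f = "\<lambda>j. 1 - (cmod (\<delta> j))\<^sup>2"
  have pos: "0 < ?f j" for j
    using \<delta>_less_1[of j] by (simp add: abs_square_less_1)
  have "convergent_prod ?f"
    using \<delta>_summable by (intro abs_convergent_prod_imp_convergent_prod summable_imp_abs_convergent_prod) auto
  note prod = this
  have lim: "(\<lambda>J. \<Prod>j\<le>J. ?f j) \<longlonglongrightarrow> prodinf ?f"
    by (rule convergent_prod_LIMSEQ[OF prod])
  have "prodinf ?f \<noteq> 0"
    by (rule prodinf_nonzero[OF prod]) (use pos in \<open>metis less_irrefl\<close>)
  have "(\<lambda>J. \<Prod>j<J. ?f j) \<longlonglongrightarrow> prodinf ?f"
    using lim unfolding lessThan_Suc_atMost[symmetric] by (rule LIMSEQ_imp_Suc)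
  then have "(\<lambda>J. 1 / sqrt (\<Prod>j<J. ?f j)) \<longlonglongrightarrow> 1 / sqrt (prodinf ?f)"
    using \<open>prodinf ?f \<noteq> 0\<close> by (intro tendsto_intros) auto
  moreover have "1 / sqrt (\<Prod>j<J. ?f j) = norm_factor J" for J
    by (induction J) (simp_all add: norm_factor_def step_norm_def real_sqrt_mult flip: divide_divide_eq_left)
  ultimately show ?thesis by (auto simp: convergent_def)
qed

lemma Lp_limit_normalized:
  assumes "1 \<le> p"
  shows "\<exists>g. Lp_limit p circle_measure (\<lambda>J z. of_real (norm_factor J) * A J z) g"
    and "\<exists>g. Lp_limit p circle_measure (\<lambda>J z. of_real (norm_factor J) * B J z) g"
proof -
  define k where "k = nat \<lceil>p\<rceil>"
  have k: "1 \<le> k" "p \<le> real (2 * k)"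
    using assms unfolding k_def by linarith+
  obtain Q where Q: "0 \<le> Q" "\<And>j. moment (2 * k) (A j) \<le> Q" "\<And>j. moment (2 * k) (B j) \<le> Q"
    using moment_lac_bounded[OF k(1)] by blast
  have c: "convergent (\<lambda>J. complex_of_real (norm_factor J))"
    using convergent_norm_factor by (auto simp: convergent_def intro: tendsto_of_real)
  have CA: "\<exists>N. \<forall>i\<ge>N. \<forall>j\<ge>i. moment (2 * k) (\<lambda>z. A j z - A i z) < e" if "0 < e" for e
    by (rule moment_lac_Cauchy[OF k(1) that]) blast
  have CB: "\<exists>N. \<forall>i\<ge>N. \<forall>j\<ge>i. moment (2 * k) (\<lambda>z. B j z - B i z) < e" if "0 < e" for e
    by (rule moment_lac_Cauchy[OF k(1) that]) blast
  have "0 < 2 * k" using k by simp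
  show "\<exists>g. Lp_limit p circle_measure (\<lambda>J z. of_real (norm_factor J) * A J z) g"
    by (rule moment_Cauchy_imp_Lp_limit[OF assms k(2) _
          moment_Cauchy_mult[OF \<open>0 < 2 * k\<close> c continuous_lac(1) Q(2) CA]])
       (intro continuous_intros continuous_lac)
  show "\<exists>g. Lp_limit p circle_measure (\<lambda>J z. of_real (norm_factor J) * B J z) g"
    by (rule moment_Cauchy_imp_Lp_limit[OF assms k(2) _
          moment_Cauchy_mult[OF \<open>0 < 2 * k\<close> c continuous_lac(2) Q(3) CB]])
       (intro continuous_intros continuous_lac)
qed

section \<open>Counting the frequencies below a truncation level\<close>

lemma strict_mono_n: "strict_mono n"
proof (intro strict_monoI_Suc)
  show "n j < n (Suc j)" for j using n_Suc[of j] n_pos[of j] by linarith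
qed

text \<open>As \<open>n\<close> is strictly increasing, the least index beyond \<open>m\<close>
  equals the number of frequencies up to \<open>m\<close>, hence the number of recursion steps
  performed by then.\<close>

definition num_freq_le :: "nat \<Rightarrow> nat" where
  "num_freq_le m = (LEAST j. m < n j)"

lemma less_num_freq_le_iff: "j < num_freq_le m \<longleftrightarrow> n j \<le> m"
proof
  show "n j \<le> m" if "j < num_freq_le m"
    using not_less_Least[OF that[unfolded num_freq_le_def]] by simp
  have "m < n (Suc m)"
    using seq_suble[OF strict_mono_n, of "Suc m"] by simp
  then have "m < n (num_freq_le m)" unfolding num_freq_le_def by (rule LeastI)
  then show "j < num_freq_le m" if "n j \<le> m"
    using that strict_mono_less[OF strict_mono_n] by (meson le_less_trans)
qed

lemma num_freq_le_eqI: "(\<And>j. j < J \<longleftrightarrow> n j \<le> m) \<Longrightarrow> num_freq_le m = J"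
  by (metis less_num_freq_le_iff linorder_neqE_nat less_irrefl)

lemma filterlim_num_freq_le: "filterlim num_freq_le at_top sequentially"
  unfolding filterlim_at_top
proof
  fix Z
  have "Z \<le> num_freq_le N" if "n Z \<le> N" for N
    using that less_num_freq_le_iff[of Z N] by simp
  then show "\<forall>\<^sub>F N in sequentially. Z \<le> num_freq_le N"
    by (auto simp: eventually_sequentially)
qed

end

section \<open>Identification of the matrix entries with the lacunary recursion\<close>

lemma X_matrix_column:
  fixes F :: "int \<Rightarrow> complex"
  assumes "- int N \<le> m"
  defines "r \<equiv> complex_of_real (1 / sqrt (1 - (cmod (trunc N F m))\<^sup>2))"
  shows "X_matrix N F z m $ 1 $ 1 = r * (X_matrix N F z (m - 1) $ 1 $ 1 +
      cnj (trunc N F m) * z powi (- m) * X_matrix N F z (m - 1) $ 2 $ 1)"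
    and "X_matrix N F z m $ 2 $ 1 = r * (X_matrix N F z (m - 1) $ 2 $ 1 +
      trunc N F m * z powi m * X_matrix N F z (m - 1) $ 1 $ 1)"
proof -
  define c where "c = trunc N F m"
  define X where "X = X_matrix N F z (m - 1)"
  define t where "t = 1 / sqrt (1 - (cmod c)\<^sup>2)"
  have eq: "X_matrix N F z m = (t *\<^sub>R step_matrix c m z) ** X"
    using assms(1) by (subst X_matrix.simps) (simp add: c_def t_def X_def)
  have r: "r = of_real t" by (simp add: r_def t_def c_def)
  show "X_matrix N F z m $ 1 $ 1 = r * (X_matrix N F z (m - 1) $ 1 $ 1 +
      cnj (trunc N F m) * z powi (- m) * X_matrix N F z (m - 1) $ 2 $ 1)"
    unfolding eq r c_def[symmetric] X_def[symmetric]
    by (simp add: matrix_matrix_mult_def step_matrix_def sum_2 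
        scaleR_conv_of_real[where 'a = complex] algebra_simps)
  show "X_matrix N F z m $ 2 $ 1 = r * (X_matrix N F z (m - 1) $ 2 $ 1 +
      trunc N F m * z powi m * X_matrix N F z (m - 1) $ 1 $ 1)"
    unfolding eq r c_def[symmetric] X_def[symmetric]
    by (simp add: matrix_matrix_mult_def step_matrix_def sum_2 
        scaleR_conv_of_real[where 'a = complex] algebra_simps)
qed

lemma X_matrix_eq_1:
  assumes F: "\<And>k. k \<le> 0 \<Longrightarrow> F k = 0" and "m \<le> 0"
  shows "X_matrix N F z m = mat 1"
proof (cases "m < - int N")
  case True
  then show ?thesis by (subst X_matrix.simps) simp
next
  case False
  \<comment> \<open>The induction starts at -N - 1, the last index where the definition returns the
    identity outright; each later factor up to 0 is the identity because \<open>F\<close> vanishes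
    there.\<close>
  then have "- int N - 1 \<le> m" by simp
  then show ?thesis using \<open>m \<le> 0\<close>
  proof (induction m rule: int_ge_induct)
    case base
    show ?case by (subst X_matrix.simps) simp
  next
    case (step m)
    have "step_matrix 0 k z = mat 1" for k
      by (simp add: step_matrix_def mat_def vec_eq_iff forall_2)
    then show ?case
      using step F[of "m + 1"] by (subst X_matrix.simps) (simp add: trunc_def)
  qed
qed

text \<open>At a frequency \<open>m = n j\<close> the matrix product performs one recursion step and
  the scalar gains one factor. At any other \<open>m\<close> the matrix factor is the identity and
  the count stays the same.\<close>

lemma (in lacunary) X_matrix_lac:
  assumes F: "\<And>j. F (int (n j)) = \<delta> j" "\<And>k. k \<notin> range (\<lambda>j. int (n j)) \<Longrightarrow> F k = 0"
    and "m \<le> N"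
  shows "X_matrix N F z (int m) $ 1 $ 1 = of_real (norm_factor (num_freq_le m)) * A (num_freq_le m) z \<and>
    X_matrix N F z (int m) $ 2 $ 1 = of_real (norm_factor (num_freq_le m)) * B (num_freq_le m) z"
  using assms(3)
proof (induction m)
  case 0
  have "F k = 0" if "k \<le> 0" for k
  proof (rule F(2))
    show "k \<notin> range (\<lambda>j. int (n j))"
    proof
      assume "k \<in> range (\<lambda>j. int (n j))"
      then obtain j where "k = int (n j)" by blast
      with that n_pos[of j] show False by simp
    qed
  qed
  then have "X_matrix N F z 0 = mat 1" by (intro X_matrix_eq_1) auto
  moreover have "num_freq_le 0 = 0"
    using n_pos by (intro num_freq_le_eqI) (auto simp: Suc_le_eq)
  ultimately show ?case by (simp add: mat_def norm_factor_def)
next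
  case (Suc m)
  have t: "trunc N F (int (Suc m)) = F (int (Suc m))"
    using Suc.prems by (simp add: trunc_def)
  note IH = Suc.IH[OF Suc_leD[OF Suc.prems]]
  note col = X_matrix_column[of N "int (Suc m)" F z, unfolded t]
  show ?case
  proof (cases "\<exists>j. n j = Suc m")
    case True
    then obtain j where j: "n j = Suc m" by blast
    \<comment> \<open>Just before the frequency \<open>n j\<close> exactly the \<open>j\<close>
      steps 0, ..., j - 1 have been made; the step made now uses \<delta>_j and leads to index
      \<open>Suc j\<close>.\<close>
    have "num_freq_le m = j"
      by (rule num_freq_le_eqI)
         (use j strict_mono_less[OF strict_mono_n, of _ j] in \<open>simp add: less_Suc_eq_le\<close>)
    moreover have "num_freq_le (Suc m) = Suc j"
      by (rule num_freq_le_eqI)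
         (use j strict_mono_less_eq[OF strict_mono_n, of _ j] in \<open>simp add: less_Suc_eq_le\<close>)
    moreover have "F (int (Suc m)) = \<delta> j" using F(1)[of j] j by simp
    ultimately show ?thesis
      using IH col j by (simp add: norm_factor_def step_norm_def add_divide_distrib algebra_simps)
  next
    case False
    then have "num_freq_le (Suc m) = num_freq_le m"
      by (intro num_freq_le_eqI) (auto simp: less_num_freq_le_iff le_Suc_eq)
    moreover have "F (int (Suc m)) = 0"
      using False by (intro F(2)) (auto simp flip: of_nat_Suc)
    ultimately show ?thesis using IH col by simp
  qed
qed

theorem theorem1p1:
  fixes q p :: real
    and n :: "nat \<Rightarrow> nat"
    and \<delta> :: "nat \<Rightarrow> complex"
    and F :: "int \<Rightarrow> complex"
  assumes "q \<ge> 2"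
    and "\<And>j. n j \<ge> 1"
    and "n 0 = 1"
    and "\<And>j. real (n (Suc j)) / real (n j) \<ge> q"
    and "summable (\<lambda>j. (cmod (\<delta> j))\<^sup>2)"
    and "(SUP j. cmod (\<delta> j)) < 1"
    and "\<And>j. F (int (n j)) = \<delta> j"
    and "\<And>k. k \<notin> range (\<lambda>j. int (n j)) \<Longrightarrow> F k = 0"
    and "p \<ge> 2"
  shows "(\<exists>a. Lp_limit p circle_measure (nlft_a F) a) \<and>
         (\<exists>b. Lp_limit p circle_measure (nlft_b F) b)"
proof -
  \<comment> \<open>The supremum bounds each |\<delta>_j| only if the set is bounded above; this is
    derived first, from the terms of the convergent series tending to 0.\<close>
  have "(\<lambda>j. sqrt ((cmod (\<delta> j))\<^sup>2)) \<longlonglongrightarrow> sqrt 0"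
    by (intro tendsto_intros summable_LIMSEQ_zero assms)
  then have "Bseq (\<lambda>j. cmod (\<delta> j))"
    by (intro convergent_imp_Bseq) (auto simp: convergent_def)
  then have bdd: "bdd_above (range (\<lambda>j. cmod (\<delta> j)))"
    by (rule Bseq_bdd_above)
  interpret lacunary n \<delta>
  proof
    show "2 * n j \<le> n (Suc j)" for j
    proof -
      have "2 \<le> real (n (Suc j)) / real (n j)"
        using assms(1) assms(4)[of j] by linarith
      then have "2 * real (n j) \<le> real (n (Suc j))"
        using assms(2)[of j] by (simp add: le_divide_eq)
      then show ?thesis by linarith
    qed
    show "cmod (\<delta> j) < 1" for j
      using cSUP_upper[OF UNIV_I bdd, of j] assms(6) by linarith
  qed (use assms in auto)
  have eq: "nlft_a F = (\<lambda>N z. of_real (norm_factor (num_freq_le N)) * A (num_freq_le N) z)"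
    "nlft_b F = (\<lambda>N z. of_real (norm_factor (num_freq_le N)) * B (num_freq_le N) z)"
    using X_matrix_lac[OF assms(7,8) order.refl]
    by (auto simp: fun_eq_iff nlft_a_def nlft_b_def a_entry_def b_entry_def)
  have "1 \<le> p" using assms(9) by simp
  then obtain ga gb where "Lp_limit p circle_measure (\<lambda>J z. of_real (norm_factor J) * A J z) ga"
    "Lp_limit p circle_measure (\<lambda>J z. of_real (norm_factor J) * B J z) gb"
    using Lp_limit_normalized by blast
  \<comment> \<open>The limits in the number of steps \<open>J\<close> are transferred to the
    truncation level \<open>N\<close>, since the number of frequencies up to \<open>N\<close> tends
    to infinity.\<close>
  from this[THEN Lp_limit_compose, OF filterlim_num_freq_le] show ?thesis
    unfolding eq by blast
qed

end
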